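(* Let $A_c\in\mathbb{R}^{n\times n}$, $B_c\in\mathbb{R}^{n\times m}$, $A_d\in\mathbb{R}^{n\times n}$, $B_d\in\mathbb{R}^{n\times m}$, and let $\bm{\Sigma}_c:\ \dot x_c(t)=A_cx_c(t)+B_cu_c(t)$ and $\bm{\Sigma}_d:\ x_d(i+1)=A_dx_d(i)+B_du_d(i)$. Let $\tau\in\mathbb{R}_{>0}$ be a sampling time and $N\ge 1$ an integer. Then $\bm{\Sigma}_c$ is an $N$-th order interpolator of $\bm{\Sigma}_d$ with respect to the sampling time $\tau$ if and only if $$\operatorname{Im}\begin{bmatrix} A_c-\dot\phi_0(0)I & B_c & 0\\ -\sigma^\top\otimes I & 0 & 0\\ A_d-\phi_0(\tau)I & B_d & 0\\ 0 & -\phi_0(\tau)I & I\end{bmatrix}\subset \operatorname{Im}\begin{bmatrix}\psi_0^\top\otimes I & 0\\ \Psi^\top\oplus(-A_c) & -I\otimes B_c\\ \Phi^\top\otimes I & 0\\ 0 & \Phi^\top\otimes I\end{bmatrix}.$$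
   Context: For integers $k_1\le k_2$, $\llbracket k_1,k_2\rrbracket=\{k\in\mathbb{Z}: k_1\le k\le k_2\}$. $x_c(t;x_0,u_c)$ denotes the solution at time $t$ of $\dot x_c=A_cx_c+B_cu_c$ with $x_c(0)=x_0$ and input $u_c$; $x_d(i;x_0,u_d)$ denotes the solution at step $i$ of $x_d(i+1)=A_dx_d(i)+B_du_d(i)$ with $x_d(0)=x_0$ and input $u_d$. $f|_{I'}$ denotes restriction to $I'$. $\mathbb{P}_N^p$ is the space of $\mathbb{R}^p$-valued polynomials of degree at most $N$. Signal interpolation: for $\ell,p\in\mathbb{Z}_{>0}$ and $s_d:\llbracket 0,\ell\rrbracket\to\mathbb{R}^p$, a function $s_c:[0,\ell\tau]\to\mathbb{R}^p$ is an $N$-th order interpolation of $s_d$ with respect to the sampling time $\tau$ if there exist $P_0,\dots,P_{\ell-1}\in\mathbb{P}_N^p|_{[0,\tau]}$ such that for all $i\in\llbracket 0,\ell-1\rrbracket$: $s_c(i\tau)=s_d(i)$, $s_c((i+1)\tau)=s_d(i+1)$, and $s_c(i\tau+t)=P_i(t)$ for all $t\in[0,\tau]$. The set of all such $s_c$ is denoted $\mathbb{I}_N^\tau(s_d)$. System interpolation: $\bm{\Sigma}_c$ is an $N$-th order interpolator of $\bm{\Sigma}_d$ with respect to the sampling time $\tau$ if for any $\ell\in\mathbb{Z}_{>0}$, any $x_0\in\mathbb{R}^n$ and any $u_d:\llbracket 0,\ell\rrbracket\to\mathbb{R}^m$, there exists $u_c\in\mathbb{I}_N^\tau(u_d)$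 such that $x_c(\cdot;x_0,u_c)|_{[0,\ell\tau]}\in\mathbb{I}_N^\tau\big(x_d(\cdot;x_0,u_d)|_{\llbracket 0,\ell\rrbracket}\big)$. Quadrature nodes: let $\mathfrak{L}_k(t)=\frac{1}{2^k}\sum_{i=0}^{\lfloor k/2\rfloor}(-1)^i\binom{k}{i}\binom{2k-2i}{k}t^{k-2i}$ be the standard Legendre polynomial of degree $k$, and $\mathfrak{L}_k^\tau(t)=\mathfrak{L}_k(2t/\tau-1)$ the shifted one. The nodes $t_{N,0}<t_{N,1}<\dots<t_{N,N}$ are the $N+1$ distinct (real) zeros of $\mathfrak{L}_N^\tau+\mathfrak{L}_{N+1}^\tau$; they satisfy $t_{N,0}=0$ and $t_{N,N}<\tau$. For $i=0,\dots,N$ let $\phi_i(t)=\prod_{j=0,j\ne i}^{N}\frac{t-t_{N,j}}{t_{N,i}-t_{N,j}}$, with derivative $\dot\phi_i$. Define $\Phi=(\phi_1(\tau),\dots,\phi_N(\tau))^\top\in\mathbb{R}^N$; $\psi_j=(\dot\phi_1(t_{N,j}),\dots,\dot\phi_N(t_{N,j}))^\top\in\mathbb{R}^N$ for $j=0,\dots,N$; $\Psi=[\psi_1\ \psi_2\ \cdots\ \psi_N]\in\mathbb{R}^{N\times N}$; $\sigma=[\dot\phi_0(t_{N,1})\ \cdots\ \dot\phi_0(t_{N,N})]\in\mathbb{R}^{1\times N}$. $\otimes$ is the Kronecker product, $N_1\oplus M_1=N_1\otimes I+I\otimes M_1$ is the Kronecker sum of square matrices (so $\Psi^\top\oplus(-A_c)=\Psi^\top\otimes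 I_n-I_N\otimes A_c$), $\operatorname{Im}$ is the column space, and $I$, $0$ are identity and zero matrices of appropriate size. The block rows of both matrices have $n$, $nN$, $n$, $m$ rows; the block columns have $n,m,m$ columns on the left and $nN,mN$ columns on the right. *)

theory Defs
  imports
    Complex_Main
    "HOL-Computational_Algebra.Polynomial"
    "Jordan_Normal_Form.VS_Connect"
begin

section \<open>Signals and their interpolations\<close>

definition vec_polys :: "nat \<Rightarrow> nat \<Rightarrow> (real \<Rightarrow> real vec) set" where
  "vec_polys N p =
    {\<lambda>t. vec p (\<lambda>k. poly (q k) t) | q :: nat \<Rightarrow> real poly. \<forall>k<p. degree (q k) \<le> N}"

text \<open>
  A discrete signal on \<open>0, \<dots>, L\<close> and a continuous signal on \<open>[0, L\<tau>]\<close> are represented by total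
  functions of which only the values on these domains matter; no restriction operator is needed.
\<close>
definition signal_interpolations ::
  "nat \<Rightarrow> real \<Rightarrow> nat \<Rightarrow> nat \<Rightarrow> (nat \<Rightarrow> real vec) \<Rightarrow> (real \<Rightarrow> real vec) set" where
  "signal_interpolations N \<tau> p L s\<^sub>d =
    {s\<^sub>c. \<exists>P. (\<forall>i<L. P i \<in> vec_polys N p) \<and>
      (\<forall>i<L. s\<^sub>c (real i * \<tau>) = s\<^sub>d i \<and> s\<^sub>c (real (i + 1) * \<tau>) = s\<^sub>d (i + 1) \<and>
        (\<forall>t\<in>{0..\<tau>}. s\<^sub>c (real i * \<tau> + t) = P i t))}"

section \<open>Linear systems\<close>

primrec dt_state ::
  "real mat \<Rightarrow> real mat \<Rightarrow> real vec \<Rightarrow> (nat \<Rightarrow> real vec) \<Rightarrow> nat \<Rightarrow> real vec" where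
  "dt_state A B x\<^sub>0 u 0 = x\<^sub>0"
| "dt_state A B x\<^sub>0 u (Suc i) = A *\<^sub>v dt_state A B x\<^sub>0 u i + B *\<^sub>v u i"

text \<open>
  The type of vectors carries no topology, so the differential equation is stated componentwise.
  For a continuous input the solution on \<open>[0, T]\<close> exists, and its values there are unique.
\<close>
definition ct_solution ::
  "real mat \<Rightarrow> real mat \<Rightarrow> real \<Rightarrow> real vec \<Rightarrow> (real \<Rightarrow> real vec) \<Rightarrow> (real \<Rightarrow> real vec) \<Rightarrow> bool" where
  "ct_solution A B T x\<^sub>0 u x \<longleftrightarrow>
    x 0 = x\<^sub>0 \<and>
    (\<forall>t\<in>{0..T}. x t \<in> carrier_vec (dim_row A) \<and>
      (\<forall>k<dim_row A. ((\<lambda>s. x s $ k) has_real_derivative (A *\<^sub>v x t + B *\<^sub>v u t) $ k)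
        (at t within {0..T})))"

definition system_interpolator ::
  "nat \<Rightarrow> real \<Rightarrow> nat \<Rightarrow> nat \<Rightarrow> real mat \<Rightarrow> real mat \<Rightarrow> real mat \<Rightarrow> real mat \<Rightarrow> bool" where
  "system_interpolator N \<tau> n m A\<^sub>c B\<^sub>c A\<^sub>d B\<^sub>d \<longleftrightarrow>
    (\<forall>L>0. \<forall>x\<^sub>0\<in>carrier_vec n. \<forall>u\<^sub>d. (\<forall>i\<le>L. u\<^sub>d i \<in> carrier_vec m) \<longrightarrow>
      (\<exists>u\<^sub>c\<in>signal_interpolations N \<tau> m L u\<^sub>d.
        \<exists>x\<^sub>c. ct_solution A\<^sub>c B\<^sub>c (real L * \<tau>) x\<^sub>0 u\<^sub>c x\<^sub>c \<and>
          x\<^sub>c \<in> signal_interpolations N \<tau> n L (dt_state A\<^sub>d B\<^sub>d x\<^sub>0 u\<^sub>d)))"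

section \<open>Quadrature nodes and Lagrange polynomials\<close>

definition legendre :: "nat \<Rightarrow> real poly" where
  "legendre k = Polynomial.smult (1 / 2 ^ k)
    (\<Sum>i\<le>k div 2. Polynomial.monom
      ((-1) ^ i * real (k choose i) * real ((2 * k - 2 * i) choose k)) (k - 2 * i))"

definition shifted_legendre :: "real \<Rightarrow> nat \<Rightarrow> real poly" where
  "shifted_legendre \<tau> k = pcompose (legendre k) [:-1, 2 / \<tau>:]"

text \<open>The zero set below has \<open>N + 1\<close> elements, so \<open>node N \<tau> i\<close> is meaningful for \<open>i \<le> N\<close>.\<close>
definition node :: "nat \<Rightarrow> real \<Rightarrow> nat \<Rightarrow> real" where
  "node N \<tau> i =
    sorted_list_of_set {t. poly (shifted_legendre \<tau> N + shifted_legendre \<tau> (N + 1)) t = 0} ! i"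

definition lagrange :: "nat \<Rightarrow> real \<Rightarrow> nat \<Rightarrow> real poly" where
  "lagrange N \<tau> i =
    (\<Prod>j\<in>{0..N} - {i}.
      Polynomial.smult (1 / (node N \<tau> i - node N \<tau> j)) [:- node N \<tau> j, 1:])"

text \<open>
  Matrix indices start at 0, whereas the entries of the vectors below are numbered from 1;
  hence the shifts by one.
\<close>
definition Phi_mat :: "nat \<Rightarrow> real \<Rightarrow> real mat" where
  "Phi_mat N \<tau> = mat N 1 (\<lambda>(i, _). poly (lagrange N \<tau> (i + 1)) \<tau>)"

definition psi_mat :: "nat \<Rightarrow> real \<Rightarrow> nat \<Rightarrow> real mat" where
  "psi_mat N \<tau> j = mat N 1 (\<lambda>(i, _). poly (pderiv (lagrange N \<tau> (i + 1))) (node N \<tau> j))"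

definition Psi_mat :: "nat \<Rightarrow> real \<Rightarrow> real mat" where
  "Psi_mat N \<tau> = mat N N (\<lambda>(i, j). psi_mat N \<tau> (j + 1) $$ (i, 0))"

definition sigma_mat :: "nat \<Rightarrow> real \<Rightarrow> real mat" where
  "sigma_mat N \<tau> = mat 1 N (\<lambda>(_, j). poly (pderiv (lagrange N \<tau> 0)) (node N \<tau> (j + 1)))"

section \<open>Matrix operations\<close>

definition kronecker_prod :: "real mat \<Rightarrow> real mat \<Rightarrow> real mat" (infixl \<open>\<otimes>\<^sub>k\<close> 71) where
  "A \<otimes>\<^sub>k B = mat (dim_row A * dim_row B) (dim_col A * dim_col B)
    (\<lambda>(i, j). A $$ (i div dim_row B, j div dim_col B) * B $$ (i mod dim_row B, j mod dim_col B))"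

definition kronecker_sum :: "real mat \<Rightarrow> real mat \<Rightarrow> real mat" (infixl \<open>\<oplus>\<^sub>k\<close> 67) where
  "A \<oplus>\<^sub>k B = A \<otimes>\<^sub>k 1\<^sub>m (dim_row B) + 1\<^sub>m (dim_row A) \<otimes>\<^sub>k B"

text \<open>Horizontal concatenation, binding tighter than the vertical concatenation \<open>@\<^sub>r\<close>.\<close>
definition append_cols :: "real mat \<Rightarrow> real mat \<Rightarrow> real mat" (infixr \<open>@\<^sub>c\<close> 66) where
  "A @\<^sub>c B = four_block_mat A B (0\<^sub>m 0 (dim_col A)) (0\<^sub>m 0 (dim_col B))"

abbreviation col_space :: "real mat \<Rightarrow> real vec set" where
  "col_space A \<equiv> vec_space.col_space (dim_row A) A"

end

(*
  A single sampling interval suffices: solutions that match at the sampling instants can be glued.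
  On such an interval the input and the state are polynomials of degree at most N, so the
  differential equation equates polynomials of degree at most N and holds as soon as it holds at
  N + 1 distinct points. At the quadrature nodes, with the polynomials expressed through their
  nodal values by Lagrange interpolation, it becomes a linear system, which together with the end
  conditions is the block system of the theorem; its solvability for all data is the inclusion of
  column spaces.

  Of the nodes one only needs that they are N + 1 distinct numbers, the least being 0. By
  Rodrigues' formula, the sum of the Legendre polynomials of degrees N and N + 1 is a multiple of
  the N-th derivative of (x + 1)^(N + 1) (x - 1)^N, and Rolle's theorem yields N zeros in (-1, 1)
  besides the zero -1.
*)
theory Submission
  imports Defs
begin

section \<open>Zeros of sums of consecutive Legendre polynomials\<close>

lemma higher_pderiv_monom_fact:
  fixes c :: "'a :: field_char_0"
  shows "(pderiv ^^ k) (Polynomial.monom c a) =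
    (if k \<le> a then Polynomial.monom (fact a / fact (a - k) * c) (a - k) else 0)"
proof (induction k)
  case (Suc k)
  show ?case
  proof (cases "Suc k \<le> a")
    case True
    then have *: "a - k = Suc (a - Suc k)" by simp
    have "of_nat (a - k) * (fact a / fact (a - k) * c) = fact a / fact (a - Suc k) * (c :: 'a)"
      unfolding * fact_Suc by (simp del: of_nat_Suc)
    with Suc True show ?thesis by (simp add: pderiv_monom)
  qed (use Suc in \<open>auto simp: pderiv_monom\<close>)
qed simp

lemma smult_sum_right: "Polynomial.smult c (\<Sum>i\<in>I. f i) = (\<Sum>i\<in>I. Polynomial.smult c (f i))"
  by (induction I rule: infinite_finite_induct) (simp_all add: smult_add_right)

lemma x_square_minus_one_power:
  "[:-1, 0, 1 :: real:] ^ k =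
    (\<Sum>i\<le>k. Polynomial.monom ((-1) ^ i * real (k choose i)) (2 * k - 2 * i))"
proof -
  have "[:-1, 0, 1 :: real:] = [:-1:] + Polynomial.monom 1 2"
    by (simp add: monom_altdef numeral_2_eq_2)
  then have "[:-1, 0, 1 :: real:] ^ k =
    (\<Sum>i\<le>k. of_nat (k choose i) * [:-1:] ^ i * Polynomial.monom 1 2 ^ (k - i))"
    by (simp only: binomial_ring)
  also have "\<dots> = (\<Sum>i\<le>k. Polynomial.monom ((-1) ^ i * real (k choose i)) (2 * k - 2 * i))"
  proof (rule sum.cong)
    fix i
    have "[:-1:] ^ i = [:(-1) ^ i :: real:]" by (induction i) auto
    then show "of_nat (k choose i) * [:-1:] ^ i * Polynomial.monom 1 2 ^ (k - i) =
      Polynomial.monom ((-1) ^ i * real (k choose i)) (2 * k - 2 * i)"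
      by (simp add: monom_power of_nat_poly smult_monom algebra_simps)
  qed simp
  finally show ?thesis .
qed

text \<open>Differentiate the binomial expansion of (x^2 - 1)^k termwise, k times. The terms with
  \<open>i > k div 2\<close> have degree below k and vanish; in the others the quotient of
  factorials is k! times the binomial coefficient \<open>(2 * k - 2 * i) choose k\<close>.\<close>

lemma legendre_rodrigues:
  "legendre k = Polynomial.smult (1 / (2 ^ k * fact k)) ((pderiv ^^ k) ([:-1, 0, 1:] ^ k))"
proof -
  have "(pderiv ^^ k) ([:-1, 0, 1 :: real:] ^ k) =
    (\<Sum>i\<le>k. (pderiv ^^ k) (Polynomial.monom ((-1) ^ i * real (k choose i)) (2 * k - 2 * i)))"
    by (simp add: x_square_minus_one_power higher_pderiv_sum)
  also have "\<dots> = (\<Sum>i\<le>k div 2.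
      (pderiv ^^ k) (Polynomial.monom ((-1) ^ i * real (k choose i)) (2 * k - 2 * i)))"
    by (rule sum.mono_neutral_right) (auto simp: higher_pderiv_monom_fact)
  also have "\<dots> = (\<Sum>i\<le>k div 2. Polynomial.smult (fact k) (Polynomial.monom
      ((-1) ^ i * real (k choose i) * real ((2 * k - 2 * i) choose k)) (k - 2 * i)))"
  proof (rule sum.cong)
    fix i assume "i \<in> {..k div 2}"
    then have le: "k \<le> 2 * k - 2 * i" and "2 * k - 2 * i - k = k - 2 * i" by auto
    with binomial_fact[OF le, where 'a = real]
    show "(pderiv ^^ k) (Polynomial.monom ((-1) ^ i * real (k choose i)) (2 * k - 2 * i)) =
      Polynomial.smult (fact k) (Polynomial.monom
        ((-1) ^ i * real (k choose i) * real ((2 * k - 2 * i) choose k)) (k - 2 * i))"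
      by (simp add: higher_pderiv_monom_fact smult_monom)
  qed simp
  finally show ?thesis
    by (simp add: legendre_def flip: smult_sum_right)
qed

definition legendre_kernel :: "nat \<Rightarrow> real poly" where
  "legendre_kernel N = [:1, 1:] * [:-1, 0, 1:] ^ N"

text \<open>Carrying out one of the N + 1 derivatives in Rodrigues' formula for degree N + 1 turns
  (x^2 - 1)^(N + 1) into 2 (N + 1) x (x^2 - 1)^N. The factor 2 (N + 1) cancels against the
  normalization, so both Legendre polynomials are N-th derivatives with the same constant, and the
  functions differentiated add up to (1 + x) (x^2 - 1)^N.\<close>

lemma legendre_add_legendre_Suc:
  "legendre N + legendre (Suc N) =
    Polynomial.smult (1 / (2 ^ N * fact N)) ((pderiv ^^ N) (legendre_kernel N))"
proof -
  have "pderiv ([:-1, 0, 1 :: real:] ^ Suc N) =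
      Polynomial.smult (2 * real (Suc N)) ([:0, 1:] * [:-1, 0, 1:] ^ N)"
    unfolding pderiv_power_Suc by (simp add: pderiv_pCons algebra_simps del: of_nat_Suc)
  then have "legendre (Suc N) = Polynomial.smult (1 / (2 ^ N * fact N))
      ((pderiv ^^ N) ([:0, 1:] * [:-1, 0, 1:] ^ N))"
    unfolding legendre_rodrigues funpow_Suc_right o_apply
    by (simp add: higher_pderiv_smult field_simps del: of_nat_Suc mult_pCons_left)
  moreover have "legendre_kernel N = [:-1, 0, 1:] ^ N + [:0, 1:] * [:-1, 0, 1:] ^ N"
    by (simp add: legendre_kernel_def)
  ultimately show ?thesis
    by (simp only: legendre_rodrigues higher_pderiv_add smult_add_right)
qed

lemma legendre_kernel_factored:
  "legendre_kernel N = [:1, 1:] ^ Suc N * [:-1, 1:] ^ N"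
proof -
  have "[:-1, 0, 1 :: real:] = [:1, 1:] * [:-1, 1:]" by simp
  then show ?thesis
    by (simp only: legendre_kernel_def power_mult_distrib power_Suc mult.assoc)
qed

text \<open>By the product rule, one differentiation lowers the multiplicity of a zero by at most
  one.\<close>

lemma linear_power_dvd_pderiv:
  fixes p :: "real poly"
  assumes "[:a, 1:] ^ Suc j dvd p"
  shows "[:a, 1:] ^ j dvd pderiv p"
proof -
  from assms obtain q where q: "p = [:a, 1:] ^ Suc j * q" ..
  show ?thesis
    unfolding q pderiv_mult pderiv_power_Suc
  proof (rule dvd_add)
    show "[:a, 1:] ^ j dvd [:a, 1:] ^ Suc j * pderiv q"
      by (intro dvd_mult2 le_imp_power_dvd) simp
    show "[:a, 1:] ^ j dvd q * (Polynomial.smult (of_nat (Suc j)) ([:a, 1:] ^ j) * pderiv [:a, 1:])"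
      by (rule dvd_mult, rule dvd_mult2, rule dvd_smult, rule dvd_refl)
  qed
qed

lemma higher_pderiv_eq_0_at_root:
  fixes p :: "real poly"
  assumes "[:a, 1:] ^ j dvd p" and "k < j"
  shows "poly ((pderiv ^^ k) p) (- a) = 0"
proof -
  have "[:a, 1:] ^ (j - k) dvd (pderiv ^^ k) p"
    using assms(2)
  proof (induction k)
    case (Suc k)
    then have "[:a, 1:] ^ Suc (j - Suc k) dvd (pderiv ^^ k) p" by (simp add: Suc_diff_Suc)
    from linear_power_dvd_pderiv[OF this] show ?case by simp
  qed (use assms in simp)
  moreover have "[:a, 1:] dvd [:a, 1:] ^ (j - k)" using assms(2) by (intro dvd_power) auto
  ultimately have "[:a, 1:] dvd (pderiv ^^ k) p" by (rule dvd_trans[rotated])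
  then show ?thesis by (simp add: poly_eq_0_iff_dvd)
qed

lemma poly_rolle_chain:
  fixes p :: "real poly" and x :: "nat \<Rightarrow> real"
  assumes "\<And>i. i < k \<Longrightarrow> x i < x (Suc i)" and "\<And>i. i \<le> k \<Longrightarrow> poly p (x i) = 0"
  shows "\<exists>y. \<forall>i<k. x i < y i \<and> y i < x (Suc i) \<and> poly (pderiv p) (y i) = 0"
proof -
  have "\<exists>y. i < k \<longrightarrow> x i < y \<and> y < x (Suc i) \<and> poly (pderiv p) y = 0" for i
  proof (cases "i < k")
    case True
    with poly_MVT[of "x i" "x (Suc i)" p] assms(1)[of i] assms(2)[of i] assms(2)[of "Suc i"]
    show ?thesis by auto
  qed simp
  then show ?thesis by (intro choice) blast
qed

text \<open>
  Each derivative inherits the zeros that Rolle's theorem gives between those of its predecessor;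
  the end points stay zeros until the order of the derivative reaches their multiplicities.
\<close>
lemma higher_pderiv_legendre_kernel_zeros:
  assumes "k \<le> N"
  shows "\<exists>x. (\<forall>i\<le>k. x i < x (Suc i)) \<and> x 0 = -1 \<and> x (Suc k) = 1 \<and>
    (\<forall>i\<le>k. poly ((pderiv ^^ k) (legendre_kernel N)) (x i) = 0)"
  using assms
proof (induction k)
  case 0
  show ?case
    by (rule exI[of _ "\<lambda>i. if i = 0 then -1 else 1"]) (simp add: legendre_kernel_def)
next
  case (Suc k)
  let ?p = "(pderiv ^^ k) (legendre_kernel N)"
  from Suc obtain x where x: "\<And>i. i \<le> k \<Longrightarrow> x i < x (Suc i)" "x 0 = -1" "x (Suc k) = 1"
    "\<And>i. i \<le> k \<Longrightarrow> poly ?p (x i) = 0"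
    by auto
  \<comment> \<open>The zero 1 of the kernel has multiplicity N > k, so Rolle's theorem also covers
    the last gap. The induction statement carries 1 only as a right end point because this
    multiplicity is used up at order N.\<close>
  have "poly ?p 1 = 0"
    using higher_pderiv_eq_0_at_root[of "-1" N "legendre_kernel N" k] Suc.prems
    by (simp add: legendre_kernel_factored del: power_Suc)
  with x have "poly ?p (x i) = 0" if "i \<le> Suc k" for i
    using that by (cases "i = Suc k") auto
  with poly_rolle_chain[of "Suc k" x ?p] x obtain y where
    y: "\<And>i. i \<le> k \<Longrightarrow> x i < y i \<and> y i < x (Suc i) \<and> poly (pderiv ?p) (y i) = 0"
    by (auto simp: less_Suc_eq_le)
  \<comment> \<open>The chain for order k + 1: the point -1, the k + 1 Rolle points moved up by one
    index, and the end point 1.\<close>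
  define z where "z i = (if i = 0 then -1 else if i \<le> Suc k then y (i - 1) else 1)" for i
  \<comment> \<open>The zero -1 has multiplicity N + 1 and therefore survives all N
    differentiations.\<close>
  have "poly (pderiv ?p) (-1) = 0"
    using higher_pderiv_eq_0_at_root[of 1 "Suc N" "legendre_kernel N" "Suc k"] Suc.prems
    by (simp add: legendre_kernel_factored del: power_Suc)
  then have "poly (pderiv ?p) (z i) = 0" if "i \<le> Suc k" for i
    using y[of "i - 1"] that by (auto simp: z_def)
  moreover have "z i < z (Suc i)" if "i \<le> Suc k" for i
  proof -
    consider "i = 0" | "i > 0" "i \<le> k" | "i = Suc k" using \<open>i \<le> Suc k\<close> by linarith
    then show ?thesis
    proof cases
      case 1
      with y[of 0] x(2) show ?thesis by (simp add: z_def)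
    next
      case 2
      then have "y (i - 1) < x i" "x i < y i" using y[of i] y[of "i - 1"] by auto
      with 2 show ?thesis by (simp add: z_def)
    next
      case 3
      with y[of k] x(3) show ?thesis by (simp add: z_def)
    qed
  qed
  ultimately show ?case
    by (intro exI[of _ z]) (simp add: z_def)
qed

text \<open>The Rolle chain at order N supplies N + 1 distinct zeros. There are no others: the
  kernel has degree 2 N + 1, so its N-th derivative has degree N + 1.\<close>

lemma legendre_sum_zeros:
  "\<exists>x. (\<forall>i<N. x i < x (Suc i)) \<and> x 0 = -1 \<and>
    {t. poly (legendre N + legendre (Suc N)) t = 0} = x ` {..N}"
proof -
  let ?p = "legendre N + legendre (Suc N)" and ?Z = "{t. poly (legendre N + legendre (Suc N)) t = 0}"
  obtain x where x: "\<And>i. i < N \<Longrightarrow> x i < x (Suc i)" "x 0 = -1"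
    "\<And>i. i \<le> N \<Longrightarrow> poly ((pderiv ^^ N) (legendre_kernel N)) (x i) = 0"
    using higher_pderiv_legendre_kernel_zeros[of N N] by (metis le_refl less_imp_le)
  have "Polynomial.degree (legendre_kernel N) = 2 * N + 1"
    unfolding legendre_kernel_def
    by (subst degree_mult_eq) (auto simp: degree_power_eq simp del: mult_pCons_left)
  then have deg: "Polynomial.degree ?p = N + 1"
    by (simp add: legendre_add_legendre_Suc degree_higher_pderiv)
  then have "?p \<noteq> 0" by (metis Polynomial.degree_0 add_is_0 one_neq_zero)
  have sm: "x i < x j" if "i < j" "j \<le> N" for i j
    using that
  proof (induction j)
    case (Suc j)
    with x(1)[of j] show ?case by (cases "i = j") auto
  qed simp
  have inj: "inj_on x {..N}"
    by (rule linorder_inj_onI) (use sm in \<open>fastforce+\<close>)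
  have sub: "x ` {..N} \<subseteq> ?Z"
    using x(3) by (auto simp: legendre_add_legendre_Suc)
  have "finite ?Z" using \<open>?p \<noteq> 0\<close> by (rule poly_roots_finite)
  moreover have "card ?Z \<le> card (x ` {..N})"
    using card_poly_roots_bound[OF \<open>?p \<noteq> 0\<close>] deg card_image[OF inj] by simp
  ultimately have "x ` {..N} = ?Z" using sub by (intro card_seteq) auto
  with x(1,2) show ?thesis by metis
qed

text \<open>The increasing affine map that sends -1 to 0 and 1 to \<open>\<tau>\<close> carries the
  zeros of the Legendre sum to those of the shifted sum and keeps their order.\<close>

lemma node_zero_inj_on:
  assumes "\<tau> > 0"
  shows "node N \<tau> 0 = 0" and "inj_on (node N \<tau>) {..N}"
proof -
  let ?Z = "{t. poly (shifted_legendre \<tau> N + shifted_legendre \<tau> (N + 1)) t = 0}"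
  from legendre_sum_zeros[of N] obtain x where x: "\<And>i. i < N \<Longrightarrow> x i < x (Suc i)" "x 0 = -1"
    "{t. poly (legendre N + legendre (Suc N)) t = 0} = x ` {..N}"
    by auto
  define y where "y i = \<tau> * (x i + 1) / 2" for i
  have "t \<in> ?Z \<longleftrightarrow> 2 * t / \<tau> - 1 \<in> x ` {..N}" for t
    using x(3) by (auto simp: shifted_legendre_def poly_pcompose algebra_simps)
  moreover have "2 * t / \<tau> - 1 = x i \<longleftrightarrow> t = y i" for t i
    using assms by (auto simp: y_def field_simps)
  ultimately have Z: "?Z = y ` {..N}" by auto
  have y_Suc: "y i < y (Suc i)" if "i < N" for i
    using x(1)[OF that] assms by (simp add: y_def)
  have sm: "y i < y j" if "i < j" "j \<le> N" for i j
    using that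
  proof (induction j)
    case (Suc j)
    with y_Suc[of j] show ?case by (cases "i = j") auto
  qed simp
  \<comment> \<open>A strictly increasing enumeration of the zero set is its sorted list, so
    \<open>node\<close> agrees with \<open>y\<close> index by index.\<close>
  have "sorted_wrt (<) (map y [0..<Suc N])"
    unfolding sorted_wrt_iff_nth_less by (auto intro: sm simp del: upt_Suc)
  then have "sorted_list_of_set (set (map y [0..<Suc N])) = map y [0..<Suc N]"
    by (intro sorted_list_of_set.idem_if_sorted_distinct)
       (auto simp: strict_sorted_iff simp del: upt_Suc)
  moreover have "set (map y [0..<Suc N]) = ?Z" 
    unfolding Z by (auto simp del: upt_Suc)
  ultimately have node: "node N \<tau> i = y i" if "i \<le> N" for i
    unfolding node_def using that by (simp del: upt_Suc)
  show "node N \<tau> 0 = 0" using node[of 0] x(2) by (simp add: y_def)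
  have "inj_on y {..N}" by (rule linorder_inj_onI) (use sm in \<open>fastforce+\<close>)
  then show "inj_on (node N \<tau>) {..N}" using node by (subst inj_on_cong) auto
qed

section \<open>Lagrange interpolation\<close>

lemma poly_lagrange_node:
  assumes "inj_on (node N \<tau>) {..N}" "i \<le> N" "j \<le> N"
  shows "poly (lagrange N \<tau> i) (node N \<tau> j) = (if i = j then 1 else 0)"
proof (cases "i = j")
  case True
  have "poly (Polynomial.smult (1 / (node N \<tau> i - node N \<tau> l)) [:- node N \<tau> l, 1:]) (node N \<tau> i) = 1"
    if "l \<in> {0..N} - {i}" for l
  proof -
    have "node N \<tau> i \<noteq> node N \<tau> l" using that assms by (auto dest: inj_onD)
    then have "(node N \<tau> i - node N \<tau> l) / (node N \<tau> i - node N \<tau> l) = 1" by simp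
    then show ?thesis by (simp add: diff_divide_distrib del: divide_self_if)
  qed
  then have "poly (lagrange N \<tau> i) (node N \<tau> i) = 1"
    unfolding lagrange_def poly_prod by (intro prod.neutral) blast
  with True show ?thesis by simp
next
  case False
  with assms(3) show ?thesis by (auto simp: lagrange_def poly_prod)
qed

lemma degree_lagrange_le:
  assumes "i \<le> N"
  shows "Polynomial.degree (lagrange N \<tau> i) \<le> N"
proof -
  have "Polynomial.degree (lagrange N \<tau> i) \<le>
    (\<Sum>j\<in>{0..N} - {i}. Polynomial.degree
      (Polynomial.smult (1 / (node N \<tau> i - node N \<tau> j)) [:- node N \<tau> j, 1:]))"
    unfolding lagrange_def by (rule degree_prod_sum_le[unfolded o_def]) simp
  also have "\<dots> \<le> (\<Sum>j\<in>{0..N} - {i}. 1)"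
    by (intro sum_mono) simp
  also have "\<dots> = N" using assms by simp
  finally show ?thesis .
qed

lemma degree_sum_smult_lagrange_le:
  "Polynomial.degree (\<Sum>i\<le>N. Polynomial.smult (c i) (lagrange N \<tau> i)) \<le> N"
  by (intro degree_sum_le order_trans[OF degree_smult_le]) (auto intro: degree_lagrange_le)

lemma poly_eq_at_nodes:
  assumes "inj_on (node N \<tau>) {..N}" "Polynomial.degree p \<le> N" "Polynomial.degree q \<le> N"
    and "\<And>j. j \<le> N \<Longrightarrow> poly p (node N \<tau> j) = poly q (node N \<tau> j)"
  shows "p = q"
  by (rule poly_eqI_degree[of "node N \<tau> ` {..N}"]) (use assms in \<open>auto simp: card_image\<close>)

lemma poly_sum_smult_lagrange_node:
  assumes "inj_on (node N \<tau>) {..N}" "j \<le> N"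
  shows "poly (\<Sum>i\<le>N. Polynomial.smult (c i) (lagrange N \<tau> i)) (node N \<tau> j) = c j"
proof -
  have "poly (\<Sum>i\<le>N. Polynomial.smult (c i) (lagrange N \<tau> i)) (node N \<tau> j) =
      (\<Sum>i\<le>N. if i = j then c i else 0)"
    unfolding poly_sum using assms by (intro sum.cong) (simp_all add: poly_lagrange_node)
  with assms(2) show ?thesis by simp
qed

lemma lagrange_expansion:
  assumes "inj_on (node N \<tau>) {..N}" "Polynomial.degree p \<le> N"
  shows "p = (\<Sum>i\<le>N. Polynomial.smult (poly p (node N \<tau> i)) (lagrange N \<tau> i))"
  by (rule poly_eq_at_nodes[OF assms(1,2) degree_sum_smult_lagrange_le])
     (simp add: poly_sum_smult_lagrange_node[OF assms(1)])

section \<open>Reduction to a single sampling interval\<close>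

text \<open>The differential equation as an identity between polynomials, for state components
  \<open>p\<close> and input components \<open>q\<close>; no interval or limit is involved.\<close>

definition poly_flow ::
  "nat \<Rightarrow> nat \<Rightarrow> real mat \<Rightarrow> real mat \<Rightarrow> (nat \<Rightarrow> real poly) \<Rightarrow> (nat \<Rightarrow> real poly) \<Rightarrow> bool" where
  "poly_flow n m A B p q \<longleftrightarrow> (\<forall>k<n. pderiv (p k) =
    (\<Sum>l<n. Polynomial.smult (A $$ (k, l)) (p l)) + (\<Sum>l<m. Polynomial.smult (B $$ (k, l)) (q l)))"

text \<open>The interpolation property on one sampling interval. The end state \<open>x1\<close> is
  a free parameter here; the discrete system enters only when it is set to the successor of
  \<open>x0\<close>.\<close>

definition one_step_interpolable ::
  "nat \<Rightarrow> real \<Rightarrow> nat \<Rightarrow> nat \<Rightarrow> real mat \<Rightarrow> real mat \<Rightarrow> real vec \<Rightarrow> real vec \<Rightarrow> real vec \<Rightarrow> real vec \<Rightarrow> bool"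
where
  "one_step_interpolable N \<tau> n m A B x0 x1 u0 u1 \<longleftrightarrow>
    (\<exists>p q. (\<forall>k<n. Polynomial.degree (p k) \<le> N \<and> poly (p k) 0 = x0 $ k \<and> poly (p k) \<tau> = x1 $ k) \<and>
      (\<forall>k<m. Polynomial.degree (q k) \<le> N \<and> poly (q k) 0 = u0 $ k \<and> poly (q k) \<tau> = u1 $ k) \<and>
      poly_flow n m A B p q)"

lemma mult_mat_vec_nth:
  assumes "A \<in> carrier_mat nr nc" "v \<in> carrier_vec nc" "k < nr"
  shows "(A *\<^sub>v v) $ k = (\<Sum>l<nc. A $$ (k, l) * v $ l)"
  using assms by (auto simp: scalar_prod_def lessThan_atLeast0)

lemma poly_flow_eval:
  assumes "poly_flow n m A B p q" "A \<in> carrier_mat n n" "B \<in> carrier_mat n m" "k < n"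
  shows "poly (pderiv (p k)) t =
    (A *\<^sub>v vec n (\<lambda>k. poly (p k) t) + B *\<^sub>v vec m (\<lambda>k. poly (q k) t)) $ k"
  using assms by (simp add: poly_flow_def mult_mat_vec_nth poly_sum del: index_mult_mat_vec)

lemma poly_eq_on_interval:
  fixes p q :: "real poly"
  assumes "a < b" "\<And>t. t \<in> {a<..<b} \<Longrightarrow> poly p t = poly q t"
  shows "p = q"
proof -
  have "infinite {a<..<b}" using assms(1) by (rule infinite_Ioo)
  then have "infinite {t. poly (p - q) t = 0}"
    by (rule contrapos_nn) (erule finite_subset[rotated], use assms(2) in auto)
  then show ?thesis using poly_roots_finite[of "p - q"] by auto
qed

text \<open>The filter at \<open>t\<close> within a union of two sets is the supremum of the two
  filters, so a common derivative on adjacent intervals is a derivative on their union. Intervals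
  are appended one at a time.\<close>

lemma has_real_derivative_glue:
  fixes f :: "real \<Rightarrow> real"
  assumes "\<tau> > 0" "L > 0"
    and "\<And>i. i < L \<Longrightarrow> t \<in> {real i * \<tau>..real (i + 1) * \<tau>} \<Longrightarrow>
      (f has_real_derivative D) (at t within {real i * \<tau>..real (i + 1) * \<tau>})"
  shows "(f has_real_derivative D) (at t within {0..real L * \<tau>})"
  using assms(2,3)
proof (induction L)
  case (Suc L)
  let ?I = "{real L * \<tau>..real (L + 1) * \<tau>}"
  have last: "(f has_real_derivative D) (at t within ?I)"
  proof (cases "t \<in> ?I")
    \<comment> \<open>Away from the closed interval the filter is trivial and every number is a
      derivative within it. Hence the hypothesis is asked only for intervals that contain
      \<open>t\<close>.\<close>
    case False
    then have "at t within ?I = bot"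
      using at_within_nhd[of t "- ?I" ?I "{}"] by (simp add: open_Compl)
    then show ?thesis by (simp add: has_field_derivative_iff)
  qed (use Suc.prems in auto)
  show ?case
  proof (cases "L = 0")
    case True
    with last show ?thesis by simp
  next
    case False
    have "{0..real (Suc L) * \<tau>} = {0..real L * \<tau>} \<union> ?I"
      using assms(1) ivl_disj_un_two_touch(4)[of 0 "real L * \<tau>" "real (L + 1) * \<tau>"] by simp
    moreover have "(f has_real_derivative D) (at t within {0..real L * \<tau>})"
      using False by (intro Suc.IH Suc.prems(2)) auto
    ultimately show ?thesis
      using last unfolding has_field_derivative_iff by (simp only: at_within_union filterlim_sup)
  qed
qed simp

text \<open>Specialize to \<open>L = 1\<close> and the discrete input \<open>u0\<close>,
  \<open>u1\<close>. State and input are then single polynomial pieces, and the differential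
  equation on the interval forces a polynomial identity.\<close>

lemma interpolator_imp_one_step:
  assumes A: "A\<^sub>c \<in> carrier_mat n n" and B: "B\<^sub>c \<in> carrier_mat n m" and "\<tau> > 0"
    and "A\<^sub>d \<in> carrier_mat n n" and "B\<^sub>d \<in> carrier_mat n m"
    and int: "system_interpolator N \<tau> n m A\<^sub>c B\<^sub>c A\<^sub>d B\<^sub>d"
    and x0: "x0 \<in> carrier_vec n" and u: "u0 \<in> carrier_vec m" "u1 \<in> carrier_vec m"
  shows "one_step_interpolable N \<tau> n m A\<^sub>c B\<^sub>c x0 (A\<^sub>d *\<^sub>v x0 + B\<^sub>d *\<^sub>v u0) u0 u1"
proof -
  let ?u = "\<lambda>i :: nat. if i = 0 then u0 else u1"
  have "\<exists>u\<in>signal_interpolations N \<tau> m 1 ?u. \<exists>x. ct_solution A\<^sub>c B\<^sub>c (real 1 * \<tau>) x0 u x \<and>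
      x \<in> signal_interpolations N \<tau> n 1 (dt_state A\<^sub>d B\<^sub>d x0 ?u)"
    by (rule int[unfolded system_interpolator_def, rule_format]) (use x0 u in auto)
  then obtain u x where ui: "u \<in> signal_interpolations N \<tau> m 1 ?u"
    and sol: "ct_solution A\<^sub>c B\<^sub>c (real 1 * \<tau>) x0 u x"
    and xi: "x \<in> signal_interpolations N \<tau> n 1 (dt_state A\<^sub>d B\<^sub>d x0 ?u)"
    by blast
  from ui obtain q where q: "\<And>k. k < m \<Longrightarrow> Polynomial.degree (q k) \<le> N"
      "u 0 = u0" "u \<tau> = u1" "\<And>t. t \<in> {0..\<tau>} \<Longrightarrow> u t = vec m (\<lambda>k. poly (q k) t)"
    by (fastforce simp: signal_interpolations_def vec_polys_def)
  from xi obtain p where p: "\<And>k. k < n \<Longrightarrow> Polynomial.degree (p k) \<le> N"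
      "x 0 = x0" "x \<tau> = A\<^sub>d *\<^sub>v x0 + B\<^sub>d *\<^sub>v u0"
      "\<And>t. t \<in> {0..\<tau>} \<Longrightarrow> x t = vec n (\<lambda>k. poly (p k) t)"
    by (fastforce simp: signal_interpolations_def vec_polys_def)
  have "pderiv (p k) = (\<Sum>l<n. Polynomial.smult (A\<^sub>c $$ (k, l)) (p l)) +
      (\<Sum>l<m. Polynomial.smult (B\<^sub>c $$ (k, l)) (q l))" (is "_ = ?rhs") if k: "k < n" for k
  proof (rule poly_eq_on_interval[OF \<open>\<tau> > 0\<close>])
    \<comment> \<open>Interior points suffice to identify polynomials, and there the derivative
      within the interval is the ordinary one, hence unique.\<close>
    fix t assume t: "t \<in> {0<..<\<tau>}"
    have "((\<lambda>s. x s $ k) has_real_derivative (A\<^sub>c *\<^sub>v x t + B\<^sub>c *\<^sub>v u t) $ k) (at t within {0..\<tau>})"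
      using sol t k A by (simp add: ct_solution_def)
    moreover have "(A\<^sub>c *\<^sub>v x t + B\<^sub>c *\<^sub>v u t) $ k = poly ?rhs t"
      using p(4)[of t] q(4)[of t] t A B k
      by (simp add: mult_mat_vec_nth poly_sum del: index_mult_mat_vec)
    ultimately have "((\<lambda>s. x s $ k) has_real_derivative poly ?rhs t) (at t within {0..\<tau>})"
      by simp
    then have "(poly (p k) has_real_derivative poly ?rhs t) (at t within {0..\<tau>})"
      by (rule has_field_derivative_transform_within[where d = 1]) (use p(4) k t in auto)
    then have "(poly (p k) has_real_derivative poly ?rhs t) (at t)"
      using t by (simp add: at_within_Icc_at)
    then show "poly (pderiv (p k)) t = poly ?rhs t"
      using DERIV_unique poly_DERIV by blast
  qed
  then have "poly_flow n m A\<^sub>c B\<^sub>c p q" by (simp add: poly_flow_def)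
  moreover have "poly (p k) 0 = x0 $ k" "poly (p k) \<tau> = (A\<^sub>d *\<^sub>v x0 + B\<^sub>d *\<^sub>v u0) $ k" if "k < n" for k
    using that \<open>\<tau> > 0\<close> unfolding p(3)[symmetric] unfolding p(2)[symmetric] by (simp_all add: p(4))
  moreover have "poly (q k) 0 = u0 $ k" "poly (q k) \<tau> = u1 $ k" if "k < m" for k
    using that \<open>\<tau> > 0\<close> unfolding q(2)[symmetric] q(3)[symmetric] by (simp_all add: q(4))
  ultimately show ?thesis
    unfolding one_step_interpolable_def using p(1) q(1) by blast
qed

section \<open>Gluing pieces over consecutive sampling intervals\<close>

lemma sampling_interval_exists:
  assumes "\<tau> > 0" "L > 0" "t \<in> {0..real L * \<tau>}"
  shows "\<exists>i<L. t \<in> {real i * \<tau>..real (i + 1) * \<tau>}"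
  using assms(2,3)
proof (induction L)
  case (Suc L)
  show ?case
  proof (cases "L > 0 \<and> t \<le> real L * \<tau>")
    case True
    with Suc show ?thesis by (auto intro: less_SucI)
  next
    case False
    with Suc.prems show ?thesis by (intro exI[of _ L]) auto
  qed
qed simp

text \<open>The piece is selected by the floor of \<open>t / \<tau>\<close>. At an interior sampling
  instant this selects the later piece, which is harmless because neighbouring pieces agree
  there.\<close>

lemma glue_pieces:
  fixes f :: "nat \<Rightarrow> real \<Rightarrow> 'a"
  assumes "\<tau> > 0" and match: "\<And>i. Suc i < L \<Longrightarrow> f i \<tau> = f (Suc i) 0"
  shows "\<exists>g. \<forall>i<L. \<forall>t\<in>{0..\<tau>}. g (real i * \<tau> + t) = f i t"
proof -
  \<comment> \<open>The minimum with \<open>L - 1\<close> assigns the final instant to the last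
    piece, which has no successor.\<close>
  define idx where "idx t = min (L - 1) (nat \<lfloor>t / \<tau>\<rfloor>)" for t
  define g where "g t = f (idx t) (t - real (idx t) * \<tau>)" for t
  have "g (real i * \<tau> + t) = f i t" if i: "i < L" and t: "t \<in> {0..\<tau>}" for i t
  proof (cases "t = \<tau>")
    case True
    then have "(real i * \<tau> + t) / \<tau> = real (Suc i)"
      using assms(1) by (simp add: field_simps)
    then have idx: "idx (real i * \<tau> + t) = min (L - 1) (Suc i)"
      unfolding idx_def by (simp only: floor_of_nat nat_int)
    show ?thesis
    proof (cases "Suc i < L")
      case True
      with idx have "idx (real i * \<tau> + t) = Suc i" by simp
      with True \<open>t = \<tau>\<close> match[of i] show ?thesis by (simp add: g_def algebra_simps)
    next
      case False
      with i idx have "idx (real i * \<tau> + t) = i" by simp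
      then show ?thesis by (simp add: g_def)
    qed
  next
    case False
    with t have "0 \<le> t / \<tau>" "t / \<tau> < 1" using assms(1) by auto
    moreover have "(real i * \<tau> + t) / \<tau> = real i + t / \<tau>"
      using assms(1) by (simp add: field_simps)
    ultimately have "\<lfloor>(real i * \<tau> + t) / \<tau>\<rfloor> = int i"
      by (simp add: floor_eq_iff)
    then have "idx (real i * \<tau> + t) = i" using i by (simp add: idx_def)
    then show ?thesis by (simp add: g_def)
  qed
  then show ?thesis by blast
qed

lemma signal_interpolationsI:
  assumes "\<tau> > 0" and "\<And>i k. i < L \<Longrightarrow> k < d \<Longrightarrow> Polynomial.degree (q i k) \<le> N"
    and start: "\<And>i. i < L \<Longrightarrow> vec d (\<lambda>k. poly (q i k) 0) = v i"
    and stop: "\<And>i. i < L \<Longrightarrow> vec d (\<lambda>k. poly (q i k) \<tau>) = v (Suc i)"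
    and s: "\<And>i t. i < L \<Longrightarrow> t \<in> {0..\<tau>} \<Longrightarrow> s (real i * \<tau> + t) = vec d (\<lambda>k. poly (q i k) t)"
  shows "s \<in> signal_interpolations N \<tau> d L v"
proof -
  have "s (real i * \<tau>) = v i" "s (real (i + 1) * \<tau>) = v (i + 1)" if "i < L" for i
    using s[OF that, of 0] s[OF that, of \<tau>] start[OF that] stop[OF that] \<open>\<tau> > 0\<close>
    by (simp_all add: distrib_right add.commute)
  with assms(2) s show ?thesis
    unfolding signal_interpolations_def vec_polys_def
    by (intro CollectI exI[of _ "\<lambda>i t. vec d (\<lambda>k. poly (q i k) t)"]) blast
qed

text \<open>The intervals are solved independently, each between consecutive samples of the discrete
  state and input. Since both end values are prescribed by these samples, neighbouring pieces fit
  together and can be glued into a solution.\<close>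

lemma one_step_imp_interpolator:
  assumes A: "A\<^sub>c \<in> carrier_mat n n" and B: "B\<^sub>c \<in> carrier_mat n m" and "\<tau> > 0"
    and Ad: "A\<^sub>d \<in> carrier_mat n n" and Bd: "B\<^sub>d \<in> carrier_mat n m"
    and step: "\<And>x0 u0 u1. x0 \<in> carrier_vec n \<Longrightarrow> u0 \<in> carrier_vec m \<Longrightarrow> u1 \<in> carrier_vec m \<Longrightarrow>
      one_step_interpolable N \<tau> n m A\<^sub>c B\<^sub>c x0 (A\<^sub>d *\<^sub>v x0 + B\<^sub>d *\<^sub>v u0) u0 u1"
  shows "system_interpolator N \<tau> n m A\<^sub>c B\<^sub>c A\<^sub>d B\<^sub>d"
  unfolding system_interpolator_def
proof (intro allI ballI impI)
  fix L :: nat and x0 :: "real vec" and v :: "nat \<Rightarrow> real vec"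
  assume "L > 0" and x0: "x0 \<in> carrier_vec n" and v: "\<forall>i\<le>L. v i \<in> carrier_vec m"
  let ?xd = "dt_state A\<^sub>d B\<^sub>d x0 v"
  have xd: "?xd i \<in> carrier_vec n" if "i \<le> L" for i
    using that by (induction i) (use x0 v Ad Bd in auto)
  \<comment> \<open>The premise \<open>i < L\<close> stands under the quantifiers so that choice
    yields \<open>p\<close> and \<open>q\<close> as functions of the interval index.\<close>
  have "\<exists>p q. i < L \<longrightarrow>
      (\<forall>k<n. Polynomial.degree (p k) \<le> N \<and> poly (p k) 0 = ?xd i $ k \<and> poly (p k) \<tau> = ?xd (Suc i) $ k) \<and>
      (\<forall>k<m. Polynomial.degree (q k) \<le> N \<and> poly (q k) 0 = v i $ k \<and> poly (q k) \<tau> = v (Suc i) $ k) \<and>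
      poly_flow n m A\<^sub>c B\<^sub>c p q" for i
    using step[OF xd, of i "v i" "v (Suc i)"] v
    unfolding one_step_interpolable_def by (cases "i < L") auto
  then obtain p q where pq: "\<And>i. i < L \<Longrightarrow>
      (\<forall>k<n. Polynomial.degree (p i k) \<le> N \<and> poly (p i k) 0 = ?xd i $ k \<and> poly (p i k) \<tau> = ?xd (Suc i) $ k) \<and>
      (\<forall>k<m. Polynomial.degree (q i k) \<le> N \<and> poly (q i k) 0 = v i $ k \<and> poly (q i k) \<tau> = v (Suc i) $ k) \<and>
      poly_flow n m A\<^sub>c B\<^sub>c (p i) (q i)"
    by metis
  let ?p = "\<lambda>i t. vec n (\<lambda>k. poly (p i k) t)" and ?q = "\<lambda>i t. vec m (\<lambda>k. poly (q i k) t)"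
  have ends: "?p i 0 = ?xd i" "?p i \<tau> = ?xd (Suc i)" "?q i 0 = v i" "?q i \<tau> = v (Suc i)"
    if "i < L" for i
    using pq[OF that] xd[of i] xd[of "Suc i"] v[rule_format, of i] v[rule_format, of "Suc i"] that
    by (auto intro!: eq_vecI simp del: dt_state.simps)
  obtain x where x: "\<And>i t. i < L \<Longrightarrow> t \<in> {0..\<tau>} \<Longrightarrow> x (real i * \<tau> + t) = ?p i t"
    using glue_pieces[of \<tau> L ?p] \<open>\<tau> > 0\<close> ends Suc_lessD by metis
  obtain u where u: "\<And>i t. i < L \<Longrightarrow> t \<in> {0..\<tau>} \<Longrightarrow> u (real i * \<tau> + t) = ?q i t"
    using glue_pieces[of \<tau> L ?q] \<open>\<tau> > 0\<close> ends Suc_lessD by metis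
  have xi: "x \<in> signal_interpolations N \<tau> n L ?xd"
    by (rule signal_interpolationsI[where q = p, OF \<open>\<tau> > 0\<close>]) (use pq ends x in blast)+
  have ui: "u \<in> signal_interpolations N \<tau> m L v"
    by (rule signal_interpolationsI[where q = q, OF \<open>\<tau> > 0\<close>]) (use pq ends u in blast)+
  have "ct_solution A\<^sub>c B\<^sub>c (real L * \<tau>) x0 u x"
    unfolding ct_solution_def
  proof (intro conjI ballI allI impI)
    show "x 0 = x0" using x[of 0 0] ends(1)[of 0] \<open>L > 0\<close> \<open>\<tau> > 0\<close> by simp
  next
    fix t assume "t \<in> {0..real L * \<tau>}"
    from sampling_interval_exists[OF \<open>\<tau> > 0\<close> \<open>L > 0\<close> this] obtain i where
      "i < L" "t \<in> {real i * \<tau>..real (i + 1) * \<tau>}" by auto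
    with x[of i "t - real i * \<tau>"] show "x t \<in> carrier_vec (dim_row A\<^sub>c)"
      using A by (simp add: algebra_simps)
  next
    fix t k assume "k < dim_row A\<^sub>c"
    then have k: "k < n" using A by simp
    show "((\<lambda>s. x s $ k) has_real_derivative (A\<^sub>c *\<^sub>v x t + B\<^sub>c *\<^sub>v u t) $ k)
      (at t within {0..real L * \<tau>})"
    proof (rule has_real_derivative_glue[OF \<open>\<tau> > 0\<close> \<open>L > 0\<close>])
      fix i assume i: "i < L" and t: "t \<in> {real i * \<tau>..real (i + 1) * \<tau>}"
      let ?I = "{real i * \<tau>..real (i + 1) * \<tau>}" and ?s = "t - real i * \<tau>"
      have "((\<lambda>r. poly (p i k) (r - real i * \<tau>)) has_real_derivative poly (pderiv (p i k)) ?s)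
          (at t within ?I)"
        by (rule has_field_derivative_at_within) (auto intro!: derivative_eq_intros poly_DERIV)
      moreover have "poly (pderiv (p i k)) ?s = (A\<^sub>c *\<^sub>v x t + B\<^sub>c *\<^sub>v u t) $ k"
        using poly_flow_eval[OF _ A B k, of "p i" "q i" ?s] pq[OF i] x[OF i, of ?s] u[OF i, of ?s] t
        by (simp add: algebra_simps)
      ultimately have "((\<lambda>r. poly (p i k) (r - real i * \<tau>)) has_real_derivative
          (A\<^sub>c *\<^sub>v x t + B\<^sub>c *\<^sub>v u t) $ k) (at t within ?I)" by simp
      then show "((\<lambda>s. x s $ k) has_real_derivative (A\<^sub>c *\<^sub>v x t + B\<^sub>c *\<^sub>v u t) $ k) (at t within ?I)"
      proof (rule has_field_derivative_transform_within[OF _ _ t, where d = 1])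
        fix r assume "r \<in> ?I"
        with x[OF i, of "r - real i * \<tau>"] k show "poly (p i k) (r - real i * \<tau>) = x r $ k"
          by (simp add: algebra_simps)
      qed simp
    qed
  qed
  with ui xi show "\<exists>u\<in>signal_interpolations N \<tau> m L v.
      \<exists>x. ct_solution A\<^sub>c B\<^sub>c (real L * \<tau>) x0 u x \<and> x \<in> signal_interpolations N \<tau> n L ?xd"
    by blast
qed

section \<open>The equations at the nodes\<close>

definition interpolant :: "nat \<Rightarrow> real \<Rightarrow> (nat \<Rightarrow> real) \<Rightarrow> real poly" where
  "interpolant N \<tau> c = (\<Sum>i\<le>N. Polynomial.smult (c i) (lagrange N \<tau> i))"

text \<open>The term of index 0 is split off because the value at the first node is given, whereas
  the values at the other N nodes become the unknowns of the linear system.\<close>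

lemma poly_interpolant:
  "poly (interpolant N \<tau> c) t =
    poly (lagrange N \<tau> 0) t * c 0 + (\<Sum>i<N. poly (lagrange N \<tau> (i + 1)) t * c (Suc i))"
  by (simp add: interpolant_def poly_sum sum.atMost_shift mult.commute)

lemma pderiv_sum: "pderiv (sum f I) = (\<Sum>i\<in>I. pderiv (f i))"
  using higher_pderiv_sum[of 1 f I] by simp

lemma poly_pderiv_interpolant:
  "poly (pderiv (interpolant N \<tau> c)) t =
    poly (pderiv (lagrange N \<tau> 0)) t * c 0 + (\<Sum>i<N. poly (pderiv (lagrange N \<tau> (i + 1))) t * c (Suc i))"
  by (simp add: interpolant_def pderiv_sum pderiv_add pderiv_smult poly_sum sum.atMost_shift mult.commute)

text \<open>The stacking order is that of the index layout in \<open>kronecker_prod\<close>.\<close>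

definition block :: "nat \<Rightarrow> real vec \<Rightarrow> nat \<Rightarrow> real vec" where
  "block d v i = vec d (\<lambda>k. v $ (i * d + k))"

text \<open>Puts the given value at the first node in front of the unknowns: \<open>V i\<close>
  belongs to node \<open>i + 1\<close>.\<close>

definition node_value :: "real vec \<Rightarrow> (nat \<Rightarrow> real vec) \<Rightarrow> nat \<Rightarrow> real vec" where
  "node_value v V i = (case i of 0 \<Rightarrow> v | Suc i \<Rightarrow> V i)"

lemma node_value_simps [simp]: "node_value v V 0 = v" "node_value v V (Suc i) = V i"
  by (simp_all add: node_value_def)

text \<open>The four groups are the four block rows, with data on the left and unknowns on the
  right: the differential equation at node 0, the same at the other nodes, the end condition on the
  state, and that on the input. The initial conditions are built in, being the values at node
  0.\<close>

definition nodal_equations :: "nat \<Rightarrow> real \<Rightarrow> nat \<Rightarrow> nat \<Rightarrow> real mat \<Rightarrow> real mat \<Rightarrow> real vec \<Rightarrow> real vec \<Rightarrow>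
    real vec \<Rightarrow> real vec \<Rightarrow> (nat \<Rightarrow> real vec) \<Rightarrow> (nat \<Rightarrow> real vec) \<Rightarrow> bool" where
  "nodal_equations N \<tau> n m A B x0 x1 u0 u1 X U \<longleftrightarrow>
    (\<forall>k<n. (A *\<^sub>v x0) $ k - poly (pderiv (lagrange N \<tau> 0)) 0 * x0 $ k + (B *\<^sub>v u0) $ k =
      (\<Sum>i<N. poly (pderiv (lagrange N \<tau> (i + 1))) 0 * X i $ k)) \<and>
    (\<forall>j<N. \<forall>k<n. - poly (pderiv (lagrange N \<tau> 0)) (node N \<tau> (j + 1)) * x0 $ k =
      (\<Sum>i<N. poly (pderiv (lagrange N \<tau> (i + 1))) (node N \<tau> (j + 1)) * X i $ k)
        - (A *\<^sub>v X j) $ k - (B *\<^sub>v U j) $ k) \<and>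
    (\<forall>k<n. x1 $ k - poly (lagrange N \<tau> 0) \<tau> * x0 $ k =
      (\<Sum>i<N. poly (lagrange N \<tau> (i + 1)) \<tau> * X i $ k)) \<and>
    (\<forall>k<m. u1 $ k - poly (lagrange N \<tau> 0) \<tau> * u0 $ k =
      (\<Sum>i<N. poly (lagrange N \<tau> (i + 1)) \<tau> * U i $ k))"

text \<open>
  Both sides of the differential equation are polynomials of degree at most \<open>N\<close>, so it holds
  identically once it holds at the \<open>N + 1\<close> nodes, the first of which is 0.
\<close>
lemma nodal_equations_iff:
  assumes A: "A \<in> carrier_mat n n" and B: "B \<in> carrier_mat n m" and "\<tau> > 0"
    and x: "x0 \<in> carrier_vec n" "\<And>j. j < N \<Longrightarrow> X j \<in> carrier_vec n"
    and u: "u0 \<in> carrier_vec m" "\<And>j. j < N \<Longrightarrow> U j \<in> carrier_vec m"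
    and p: "\<And>k. k < n \<Longrightarrow> p k = interpolant N \<tau> (\<lambda>i. node_value x0 X i $ k)"
    and q: "\<And>k. k < m \<Longrightarrow> q k = interpolant N \<tau> (\<lambda>i. node_value u0 U i $ k)"
  shows "nodal_equations N \<tau> n m A B x0 x1 u0 u1 X U \<longleftrightarrow>
    (\<forall>k<n. poly (p k) \<tau> = x1 $ k) \<and> (\<forall>k<m. poly (q k) \<tau> = u1 $ k) \<and> poly_flow n m A B p q"
proof -
  note node = node_zero_inj_on[OF \<open>\<tau> > 0\<close>]
  have deg: "Polynomial.degree (p k) \<le> N" if "k < n" for k
    using that by (simp add: p interpolant_def degree_sum_smult_lagrange_le)
  have degq: "Polynomial.degree (q k) \<le> N" if "k < m" for k
    using that by (simp add: q interpolant_def degree_sum_smult_lagrange_le)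
  have p_node: "poly (p k) (node N \<tau> j) = node_value x0 X j $ k" if "k < n" "j \<le> N" for k j
    using that by (simp add: p interpolant_def poly_sum_smult_lagrange_node[OF node(2)])
  have q_node: "poly (q k) (node N \<tau> j) = node_value u0 U j $ k" if "k < m" "j \<le> N" for k j
    using that by (simp add: q interpolant_def poly_sum_smult_lagrange_node[OF node(2)])
  have nv: "node_value x0 X j \<in> carrier_vec n" "node_value u0 U j \<in> carrier_vec m" if "j \<le> N" for j
    using that x u by (cases j; simp)+
  let ?rhs = "\<lambda>k. (\<Sum>l<n. Polynomial.smult (A $$ (k, l)) (p l)) +
    (\<Sum>l<m. Polynomial.smult (B $$ (k, l)) (q l))"
  have rhs_node: "poly (?rhs k) (node N \<tau> j) =
      (A *\<^sub>v node_value x0 X j) $ k + (B *\<^sub>v node_value u0 U j) $ k" if "k < n" "j \<le> N" for k j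
    using that p_node q_node mult_mat_vec_nth[OF A nv(1)] mult_mat_vec_nth[OF B nv(2)]
    by (simp add: poly_sum del: index_mult_mat_vec)
  have flow_iff: "pderiv (p k) = ?rhs k \<longleftrightarrow>
      (\<forall>j\<le>N. poly (pderiv (p k)) (node N \<tau> j) = poly (?rhs k) (node N \<tau> j))" if k: "k < n" for k
  proof
    have "Polynomial.degree (?rhs k) \<le> N"
      using deg degq by (intro degree_add_le degree_sum_le order_trans[OF degree_smult_le]) auto
    moreover have "Polynomial.degree (pderiv (p k)) \<le> N"
      using deg[OF k] by (simp add: degree_pderiv)
    moreover assume "\<forall>j\<le>N. poly (pderiv (p k)) (node N \<tau> j) = poly (?rhs k) (node N \<tau> j)"
    ultimately show "pderiv (p k) = ?rhs k"
      by (intro poly_eq_at_nodes[OF node(2)]) auto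
  qed simp
  have split: "(\<forall>j\<le>N. Q j) \<longleftrightarrow> Q 0 \<and> (\<forall>j<N. Q (Suc j))" for Q :: "nat \<Rightarrow> bool"
    by (metis Suc_le_eq not0_implies_Suc zero_le)
  have "poly_flow n m A B p q \<longleftrightarrow> (\<forall>k<n. \<forall>j\<le>N. poly (pderiv (p k)) (node N \<tau> j) =
      (A *\<^sub>v node_value x0 X j) $ k + (B *\<^sub>v node_value u0 U j) $ k)"
    unfolding poly_flow_def using flow_iff rhs_node by auto
  also have "\<dots> \<longleftrightarrow>
    (\<forall>k<n. poly (pderiv (p k)) 0 = (A *\<^sub>v x0) $ k + (B *\<^sub>v u0) $ k) \<and>
    (\<forall>j<N. \<forall>k<n. poly (pderiv (p k)) (node N \<tau> (j + 1)) = (A *\<^sub>v X j) $ k + (B *\<^sub>v U j) $ k)"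
    unfolding split by (auto simp: node(1) simp del: index_mult_mat_vec)
  finally have flow: "poly_flow n m A B p q \<longleftrightarrow> \<dots>" .
  \<comment> \<open>These rearrangements return the split-off data terms to the interpolation sums,
    so that each equation is about the value or derivative of an interpolant.\<close>
  have eq: "(a - b = c) = (b + c = a)" for a b c :: real by auto
  have eq0: "(a - b + a' = c) = (b + c = a + a')" for a a' b c :: real by auto
  have eq1: "(- b * z = c - a - a') = (b * z + c = a + a')" for a a' b c z :: real by auto
  show ?thesis
    unfolding flow nodal_equations_def eq eq0 eq1
    by (auto simp: p q poly_interpolant poly_pderiv_interpolant simp del: index_mult_mat_vec)
qed

lemma mult_add_less:
  fixes i k N d :: nat
  assumes "i < N" "k < d"
  shows "i * d + k < N * d"
proof -
  have "i * d + k < Suc i * d" using assms by simp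
  also have "\<dots> \<le> N * d" using assms by (intro mult_le_mono1) simp
  finally show ?thesis .
qed

text \<open>Polynomials of degree at most N correspond to their nodal values: sampling at the nodes
  after the first gives the unknowns, and interpolating the data and unknowns gives the polynomials
  back.\<close>

lemma one_step_iff_nodal_equations:
  assumes A: "A \<in> carrier_mat n n" and B: "B \<in> carrier_mat n m" and "\<tau> > 0"
    and x0: "x0 \<in> carrier_vec n" and u0: "u0 \<in> carrier_vec m"
  shows "one_step_interpolable N \<tau> n m A B x0 x1 u0 u1 \<longleftrightarrow>
    (\<exists>X\<in>carrier_vec (N * n). \<exists>U\<in>carrier_vec (N * m).
      nodal_equations N \<tau> n m A B x0 x1 u0 u1 (block n X) (block m U))"
proof
  note node = node_zero_inj_on[OF \<open>\<tau> > 0\<close>]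
  have blk: "block d (vec (N * d) (\<lambda>r. f (r mod d) (r div d))) i $ k = f k i"
    if "i < N" "k < d" for f :: "nat \<Rightarrow> nat \<Rightarrow> real" and d i k
    using mult_add_less[OF that] that by (simp add: block_def)
  have expand: "r = interpolant N \<tau> (\<lambda>i. node_value v V i $ k)"
    if "Polynomial.degree r \<le> N" "poly r 0 = v $ k" "\<And>i. i < N \<Longrightarrow> V i $ k = poly r (node N \<tau> (Suc i))"
    for r v V k
  proof -
    have "poly r (node N \<tau> i) = node_value v V i $ k" if "i \<le> N" for i
      using that \<open>poly r 0 = v $ k\<close> \<open>\<And>i. i < N \<Longrightarrow> V i $ k = _ i\<close> node(1) by (cases i) auto
    then show ?thesis
      unfolding interpolant_def
      by (subst lagrange_expansion[OF node(2) that(1)]) (intro sum.cong, auto)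
  qed
  assume "one_step_interpolable N \<tau> n m A B x0 x1 u0 u1"
  then obtain p q where
    p: "\<forall>k<n. Polynomial.degree (p k) \<le> N \<and> poly (p k) 0 = x0 $ k \<and> poly (p k) \<tau> = x1 $ k" and
    q: "\<forall>k<m. Polynomial.degree (q k) \<le> N \<and> poly (q k) 0 = u0 $ k \<and> poly (q k) \<tau> = u1 $ k" and
    "poly_flow n m A B p q"
    unfolding one_step_interpolable_def by blast
  \<comment> \<open>Entry \<open>r\<close> belongs to component \<open>r mod d\<close> at node
    \<open>Suc (r div d)\<close>; the successor skips the first node, which carries the
    data.\<close>
  let ?V = "\<lambda>d f. vec (N * d) (\<lambda>r. poly (f (r mod d)) (node N \<tau> (Suc (r div d))))"
  have "nodal_equations N \<tau> n m A B x0 x1 u0 u1 (block n (?V n p)) (block m (?V m q))"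
  proof (subst nodal_equations_iff[where p = p and q = q, OF A B \<open>\<tau> > 0\<close> x0 _ u0])
    show "p k = interpolant N \<tau> (\<lambda>i. node_value x0 (block n (?V n p)) i $ k)" if "k < n" for k
      using p that blk[where f = "\<lambda>k i. poly (p k) (node N \<tau> (Suc i))"] by (intro expand) auto
    show "q k = interpolant N \<tau> (\<lambda>i. node_value u0 (block m (?V m q)) i $ k)" if "k < m" for k
      using q that blk[where f = "\<lambda>k i. poly (q k) (node N \<tau> (Suc i))"] by (intro expand) auto
  qed (use p q \<open>poly_flow n m A B p q\<close> in \<open>auto simp: block_def\<close>)
  then show "\<exists>X\<in>carrier_vec (N * n). \<exists>U\<in>carrier_vec (N * m).
      nodal_equations N \<tau> n m A B x0 x1 u0 u1 (block n X) (block m U)"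
    by (intro bexI[of _ "?V n p"] bexI[of _ "?V m q"]) auto
next
  note node = node_zero_inj_on[OF \<open>\<tau> > 0\<close>]
  assume "\<exists>X\<in>carrier_vec (N * n). \<exists>U\<in>carrier_vec (N * m).
      nodal_equations N \<tau> n m A B x0 x1 u0 u1 (block n X) (block m U)"
  then obtain X U where eqs: "nodal_equations N \<tau> n m A B x0 x1 u0 u1 (block n X) (block m U)"
    by blast
  define p where "p k = interpolant N \<tau> (\<lambda>i. node_value x0 (block n X) i $ k)" for k
  define q where "q k = interpolant N \<tau> (\<lambda>i. node_value u0 (block m U) i $ k)" for k
  have "(\<forall>k<n. poly (p k) \<tau> = x1 $ k) \<and> (\<forall>k<m. poly (q k) \<tau> = u1 $ k) \<and> poly_flow n m A B p q"
    using eqs by (subst (asm) nodal_equations_iff[where p = p and q = q, OF A B \<open>\<tau> > 0\<close> x0 _ u0])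
      (auto simp: p_def q_def block_def)
  moreover have "poly (interpolant N \<tau> (\<lambda>i. node_value v V i $ k)) 0 = v $ k" for v V k
    using poly_sum_smult_lagrange_node[OF node(2), where j = 0 and c = "\<lambda>i. node_value v V i $ k"] node(1)
    by (simp add: interpolant_def)
  ultimately show "one_step_interpolable N \<tau> n m A B x0 x1 u0 u1"
    unfolding one_step_interpolable_def
    by (intro exI[of _ p] exI[of _ q])
       (auto simp: p_def q_def interpolant_def degree_sum_smult_lagrange_le)
qed

section \<open>Block matrices\<close>

lemma carrier_append_cols [simp, intro]:
  "A \<in> carrier_mat nr nc1 \<Longrightarrow> B \<in> carrier_mat nr nc2 \<Longrightarrow> A @\<^sub>c B \<in> carrier_mat nr (nc1 + nc2)"
  unfolding append_cols_def by (auto simp: four_block_mat_def Let_def)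

text \<open>Horizontal concatenation is a four-block matrix with empty lower blocks, so the product
  carries an extra part of dimension 0 that disappears when entries are compared.\<close>

lemma append_cols_mult_append:
  assumes "A \<in> carrier_mat nr nc1" "B \<in> carrier_mat nr nc2" "a \<in> carrier_vec nc1" "b \<in> carrier_vec nc2"
  shows "(A @\<^sub>c B) *\<^sub>v (a @\<^sub>v b) = A *\<^sub>v a + B *\<^sub>v b"
proof -
  have "(A @\<^sub>c B) *\<^sub>v (a @\<^sub>v b) =
      (A *\<^sub>v a + B *\<^sub>v b) @\<^sub>v (0\<^sub>m 0 nc1 *\<^sub>v a + 0\<^sub>m 0 nc2 *\<^sub>v b)"
    unfolding append_cols_def using assms
    by (subst four_block_mat_mult_vec[of _ nr nc1 _ nc2 _ 0]) auto
  then show ?thesis using assms by (auto intro!: eq_vecI)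
qed

section \<open>Kronecker products acting on stacked vectors\<close>

lemma carrier_kronecker_prod [simp, intro]:
  "K \<in> carrier_mat r c \<Longrightarrow> M \<in> carrier_mat r' c' \<Longrightarrow> K \<otimes>\<^sub>k M \<in> carrier_mat (r * r') (c * c')"
  unfolding kronecker_prod_def by auto

text \<open>Group the \<open>c * c'\<close> columns into \<open>c\<close> consecutive runs of length
  \<open>c'\<close>. Within run \<open>i\<close> the entry of \<open>K\<close> is constant, and what
  is left is a product of \<open>M\<close> with block \<open>i\<close> of the vector.\<close>

lemma kronecker_prod_mult_nth:
  assumes K: "K \<in> carrier_mat r c" and M: "M \<in> carrier_mat r' c'" and v: "v \<in> carrier_vec (c * c')"
    and j: "j < r" and k: "k < r'"
  shows "((K \<otimes>\<^sub>k M) *\<^sub>v v) $ (j * r' + k) = (\<Sum>i<c. K $$ (j, i) * (M *\<^sub>v block c' v i) $ k)"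
proof -
  let ?g = "\<lambda>s. (K \<otimes>\<^sub>k M) $$ (j * r' + k, s) * v $ s"
  have g: "?g (i * c' + l) = K $$ (j, i) * (M $$ (k, l) * v $ (i * c' + l))"
    if "i < c" "l < c'" for i l
    using K M that j k mult_add_less[OF j k] mult_add_less[OF that]
    by (simp add: kronecker_prod_def)
  have "((K \<otimes>\<^sub>k M) *\<^sub>v v) $ (j * r' + k) = sum ?g {..<c * c'}"
    by (rule mult_mat_vec_nth[OF carrier_kronecker_prod[OF K M] v mult_add_less[OF j k]])
  also have "\<dots> = (\<Sum>i<c. sum ?g {i * c'..<i * c' + c'})"
    by (rule sum.nat_group[symmetric])
  also have "\<dots> = (\<Sum>i<c. \<Sum>l<c'. ?g (i * c' + l))"
    by (subst sum.atLeastLessThan_shift_0) (simp add: lessThan_atLeast0)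
  also have "\<dots> = (\<Sum>i<c. K $$ (j, i) * (\<Sum>l<c'. M $$ (k, l) * v $ (i * c' + l)))"
    by (simp add: g sum_distrib_left)
  also have "\<dots> = (\<Sum>i<c. K $$ (j, i) * (M *\<^sub>v block c' v i) $ k)"
    by (rule sum.cong) (simp_all add: mult_mat_vec_nth[OF M _ k] block_def del: index_mult_mat_vec)
  finally show ?thesis .
qed

lemma kronecker_one_mult_nth:
  assumes "K \<in> carrier_mat r c" "v \<in> carrier_vec (c * d)" "j < r" "k < d"
  shows "((K \<otimes>\<^sub>k 1\<^sub>m d) *\<^sub>v v) $ (j * d + k) = (\<Sum>i<c. K $$ (j, i) * block d v i $ k)"
  using assms by (simp add: kronecker_prod_mult_nth[of K r c _ d d] block_def del: index_mult_mat_vec)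

lemma one_kronecker_mult_nth:
  assumes M: "M \<in> carrier_mat r c" and v: "v \<in> carrier_vec (N * c)" and j: "j < N" and k: "k < r"
  shows "((1\<^sub>m N \<otimes>\<^sub>k M) *\<^sub>v v) $ (j * r + k) = (M *\<^sub>v block c v j) $ k"
proof -
  have "((1\<^sub>m N \<otimes>\<^sub>k M) *\<^sub>v v) $ (j * r + k) =
      (\<Sum>i<N. 1\<^sub>m N $$ (j, i) * (M *\<^sub>v block c v i) $ k)"
    using assms by (intro kronecker_prod_mult_nth) auto
  also have "\<dots> = (\<Sum>i<N. if i = j then (M *\<^sub>v block c v i) $ k else 0)"
    using j by (intro sum.cong) auto
  finally show ?thesis using j by (simp del: index_mult_mat_vec)
qed

lemma eq_vec_blocks_iff:
  assumes "v \<in> carrier_vec (N * d)" "w \<in> carrier_vec (N * d)"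
  shows "v = w \<longleftrightarrow> (\<forall>j<N. \<forall>k<d. v $ (j * d + k) = w $ (j * d + k))"
proof
  assume eq: "\<forall>j<N. \<forall>k<d. v $ (j * d + k) = w $ (j * d + k)"
  show "v = w"
  proof (rule eq_vecI)
    fix i assume "i < dim_vec w"
    then have i: "i < N * d" using assms by simp
    \<comment> \<open>The range of indices would be empty otherwise; positivity makes
      \<open>i mod d\<close> a valid offset within a block.\<close>
    then have "d > 0" by (cases d) auto
    then have "i mod d < d" "i div d < N" using i by (simp_all add: less_mult_imp_div_less)
    with eq have "v $ (i div d * d + i mod d) = w $ (i div d * d + i mod d)" by blast
    then show "v $ i = w $ i" by simp
  qed (use assms in auto)
qed simp

text \<open>A column space is the set of all products with vectors, so inclusion means that every
  right-hand side of the form \<open>P *\<^sub>v v\<close> admits a solution.\<close>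

lemma col_space_subset_iff:
  assumes P: "P \<in> carrier_mat d c" and Q: "Q \<in> carrier_mat d c'"
  shows "col_space P \<subseteq> col_space Q \<longleftrightarrow>
    (\<forall>v\<in>carrier_vec c. \<exists>w\<in>carrier_vec c'. P *\<^sub>v v = Q *\<^sub>v w)"
proof -
  have *: "vec_space.col_space (dim_row M) M = {M *\<^sub>v x |x. x \<in> carrier_vec l}"
    if "M \<in> carrier_mat d l" for M :: "real mat" and l
    using vec_space.col_space_eq[OF that] that by auto
  show ?thesis unfolding *[OF P] *[OF Q] by blast
qed

lemma smult_mat_mult_vec:
  fixes A :: "real mat"
  assumes "A \<in> carrier_mat nr nc" "v \<in> carrier_vec nc"
  shows "(a \<cdot>\<^sub>m A) *\<^sub>v v = a \<cdot>\<^sub>v (A *\<^sub>v v)"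
  using assms by (auto intro!: eq_vecI)

lemma append_cols3_mult_append:
  assumes "A \<in> carrier_mat nr n" "B \<in> carrier_mat nr m" "C \<in> carrier_mat nr l"
    and "a \<in> carrier_vec n" "b \<in> carrier_vec m" "c \<in> carrier_vec l"
  shows "(A @\<^sub>c B @\<^sub>c C) *\<^sub>v (a @\<^sub>v b @\<^sub>v c) = A *\<^sub>v a + (B *\<^sub>v b + C *\<^sub>v c)"
  using assms by (subst append_cols_mult_append[of A nr n _ "m + l"])
    (auto simp: append_cols_mult_append[of B nr m C l])

lemma append_rows4_mult:
  assumes "R1 \<in> carrier_mat n1 c" "R2 \<in> carrier_mat n2 c" "R3 \<in> carrier_mat n3 c" "R4 \<in> carrier_mat n4 c"
    and "v \<in> carrier_vec c"
  shows "(R1 @\<^sub>r R2 @\<^sub>r R3 @\<^sub>r R4) *\<^sub>v v = (R1 *\<^sub>v v) @\<^sub>v (R2 *\<^sub>v v) @\<^sub>v (R3 *\<^sub>v v) @\<^sub>v (R4 *\<^sub>v v)"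
  using assms by (subst mat_mult_append[of _ n1 c _ "n2 + (n3 + n4)"] mat_mult_append[of _ n2 c _ "n3 + n4"]
      mat_mult_append[of _ n3 c _ n4]; auto)+

lemma eq_append_vec4_iff:
  assumes "a \<in> carrier_vec n1" "a' \<in> carrier_vec n1" "b \<in> carrier_vec n2" "b' \<in> carrier_vec n2"
    "c \<in> carrier_vec n3" "c' \<in> carrier_vec n3"
  shows "a @\<^sub>v b @\<^sub>v c @\<^sub>v d = a' @\<^sub>v b' @\<^sub>v c' @\<^sub>v d' \<longleftrightarrow> a = a' \<and> b = b' \<and> c = c' \<and> d = d'"
  using append_vec_eq[OF assms(1,2)] append_vec_eq[OF assms(3,4)] append_vec_eq[OF assms(5,6)] by simp

lemma ball_carrier_append:
  fixes Q :: "'a vec \<Rightarrow> bool"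
  shows   "(\<forall>w\<in>carrier_vec (c + d). Q w) \<longleftrightarrow> (\<forall>x\<in>carrier_vec c. \<forall>y\<in>carrier_vec d. Q (x @\<^sub>v y))"
proof (intro iffI ballI)
  fix w :: "'a vec" assume *: "\<forall>x\<in>carrier_vec c. \<forall>y\<in>carrier_vec d. Q (x @\<^sub>v y)"
    and "w \<in> carrier_vec (c + d)"
  then show "Q w"
    using vec_first_last_append[of w c d] vec_first_carrier[of w c] vec_last_carrier[of w d] by metis
qed auto

lemma bex_carrier_append:
  fixes Q :: "'a vec \<Rightarrow> bool"
  shows   "(\<exists>w\<in>carrier_vec (c + d). Q w) \<longleftrightarrow> (\<exists>x\<in>carrier_vec c. \<exists>y\<in>carrier_vec d. Q (x @\<^sub>v y))"
  using ball_carrier_append[of c d "\<lambda>w. \<not> Q w"] by blast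

lemma eq_vec_iff:
  "v \<in> carrier_vec d \<Longrightarrow> w \<in> carrier_vec d \<Longrightarrow> v = w \<longleftrightarrow> (\<forall>k<d. v $ k = w $ k)"
  by (auto intro: eq_vecI)

section \<open>The two block matrices of the theorem and the equations they encode\<close>

context
  fixes n m N :: nat and A B A' B' P0 P S F :: "real mat" and a b :: real
  assumes A: "A \<in> carrier_mat n n" and B: "B \<in> carrier_mat n m"
    and A': "A' \<in> carrier_mat n n" and B': "B' \<in> carrier_mat n m"
    and P0: "P0 \<in> carrier_mat 1 N" and P: "P \<in> carrier_mat N N"
    and S: "S \<in> carrier_mat N 1" and F: "F \<in> carrier_mat 1 N"
begin

text \<open>The quadrature data are kept abstract: \<open>a\<close> stands for the derivative of the
  first Lagrange polynomial at 0, \<open>b\<close> for its value at \<open>\<tau>\<close>, and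
  \<open>S\<close>, \<open>P0\<close>, \<open>P\<close>, \<open>F\<close> for the transposes of
  sigma, psi_0, Psi and Phi.\<close>

definition lhs_mat :: "real mat" where
  "lhs_mat =
    ((A - a \<cdot>\<^sub>m 1\<^sub>m n) @\<^sub>c B @\<^sub>c 0\<^sub>m n m) @\<^sub>r
    (- (S \<otimes>\<^sub>k 1\<^sub>m n) @\<^sub>c 0\<^sub>m (n * N) m @\<^sub>c 0\<^sub>m (n * N) m) @\<^sub>r
    ((A' - b \<cdot>\<^sub>m 1\<^sub>m n) @\<^sub>c B' @\<^sub>c 0\<^sub>m n m) @\<^sub>r
    (0\<^sub>m m n @\<^sub>c - (b \<cdot>\<^sub>m 1\<^sub>m m) @\<^sub>c 1\<^sub>m m)"

definition rhs_mat :: "real mat" where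
  "rhs_mat =
    (P0 \<otimes>\<^sub>k 1\<^sub>m n @\<^sub>c 0\<^sub>m n (m * N)) @\<^sub>r
    (P \<oplus>\<^sub>k (- A) @\<^sub>c - (1\<^sub>m N \<otimes>\<^sub>k B)) @\<^sub>r
    (F \<otimes>\<^sub>k 1\<^sub>m n @\<^sub>c 0\<^sub>m n (m * N)) @\<^sub>r
    (0\<^sub>m m (n * N) @\<^sub>c F \<otimes>\<^sub>k 1\<^sub>m m)"

lemma kronecker_carriers:
  "S \<otimes>\<^sub>k 1\<^sub>m n \<in> carrier_mat (N * n) n" "P0 \<otimes>\<^sub>k 1\<^sub>m n \<in> carrier_mat n (N * n)"
  "F \<otimes>\<^sub>k 1\<^sub>m n \<in> carrier_mat n (N * n)" "F \<otimes>\<^sub>k 1\<^sub>m m \<in> carrier_mat m (N * m)"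
  "P \<otimes>\<^sub>k 1\<^sub>m n \<in> carrier_mat (N * n) (N * n)" "1\<^sub>m N \<otimes>\<^sub>k B \<in> carrier_mat (N * n) (N * m)"
  "1\<^sub>m N \<otimes>\<^sub>k (- A) \<in> carrier_mat (N * n) (N * n)"
  using carrier_kronecker_prod[OF S one_carrier_mat[of n]] carrier_kronecker_prod[OF P0 one_carrier_mat[of n]]
    carrier_kronecker_prod[OF F one_carrier_mat[of n]] carrier_kronecker_prod[OF F one_carrier_mat[of m]]
    carrier_kronecker_prod[OF one_carrier_mat[of N] B] carrier_kronecker_prod[OF P one_carrier_mat[of n]]
    carrier_kronecker_prod[OF one_carrier_mat[of N] uminus_carrier_mat[OF A]]
  by simp_all

lemma kronecker_sum_expand: "P \<oplus>\<^sub>k (- A) = P \<otimes>\<^sub>k 1\<^sub>m n + 1\<^sub>m N \<otimes>\<^sub>k (- A)"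
  using A P by (simp add: kronecker_sum_def)

lemma row_carriers:
  "(A - a \<cdot>\<^sub>m 1\<^sub>m n) @\<^sub>c B @\<^sub>c 0\<^sub>m n m \<in> carrier_mat n (n + (m + m))"
  "- (S \<otimes>\<^sub>k 1\<^sub>m n) @\<^sub>c 0\<^sub>m (n * N) m @\<^sub>c 0\<^sub>m (n * N) m \<in> carrier_mat (N * n) (n + (m + m))"
  "(A' - b \<cdot>\<^sub>m 1\<^sub>m n) @\<^sub>c B' @\<^sub>c 0\<^sub>m n m \<in> carrier_mat n (n + (m + m))"
  "0\<^sub>m m n @\<^sub>c - (b \<cdot>\<^sub>m 1\<^sub>m m) @\<^sub>c 1\<^sub>m m \<in> carrier_mat m (n + (m + m))"
  "P0 \<otimes>\<^sub>k 1\<^sub>m n @\<^sub>c 0\<^sub>m n (m * N) \<in> carrier_mat n (N * n + N * m)"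
  "P \<oplus>\<^sub>k (- A) @\<^sub>c - (1\<^sub>m N \<otimes>\<^sub>k B) \<in> carrier_mat (N * n) (N * n + N * m)"
  "F \<otimes>\<^sub>k 1\<^sub>m n @\<^sub>c 0\<^sub>m n (m * N) \<in> carrier_mat n (N * n + N * m)"
  "0\<^sub>m m (n * N) @\<^sub>c F \<otimes>\<^sub>k 1\<^sub>m m \<in> carrier_mat m (N * n + N * m)"
proof -
  note k = kronecker_carriers
  have s: "P \<oplus>\<^sub>k (- A) \<in> carrier_mat (N * n) (N * n)"
    unfolding kronecker_sum_expand by (intro add_carrier_mat k)
  show "(A - a \<cdot>\<^sub>m 1\<^sub>m n) @\<^sub>c B @\<^sub>c 0\<^sub>m n m \<in> carrier_mat n (n + (m + m))"
    by (intro carrier_append_cols minus_carrier_mat uminus_carrier_mat smult_carrier_mat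
        one_carrier_mat zero_carrier_mat A B A' B' k s; simp add: mult.commute)
  show "- (S \<otimes>\<^sub>k 1\<^sub>m n) @\<^sub>c 0\<^sub>m (n * N) m @\<^sub>c 0\<^sub>m (n * N) m \<in> carrier_mat (N * n) (n + (m + m))"
    by (intro carrier_append_cols minus_carrier_mat uminus_carrier_mat smult_carrier_mat
        one_carrier_mat zero_carrier_mat A B A' B' k s; simp add: mult.commute)
  show "(A' - b \<cdot>\<^sub>m 1\<^sub>m n) @\<^sub>c B' @\<^sub>c 0\<^sub>m n m \<in> carrier_mat n (n + (m + m))"
    by (intro carrier_append_cols minus_carrier_mat uminus_carrier_mat smult_carrier_mat
        one_carrier_mat zero_carrier_mat A B A' B' k s; simp add: mult.commute)
  show "0\<^sub>m m n @\<^sub>c - (b \<cdot>\<^sub>m 1\<^sub>m m) @\<^sub>c 1\<^sub>m m \<in> carrier_mat m (n + (m + m))"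
    by (intro carrier_append_cols minus_carrier_mat uminus_carrier_mat smult_carrier_mat
        one_carrier_mat zero_carrier_mat A B A' B' k s; simp add: mult.commute)
  show "P0 \<otimes>\<^sub>k 1\<^sub>m n @\<^sub>c 0\<^sub>m n (m * N) \<in> carrier_mat n (N * n + N * m)"
    by (intro carrier_append_cols minus_carrier_mat uminus_carrier_mat smult_carrier_mat
        one_carrier_mat zero_carrier_mat A B A' B' k s; simp add: mult.commute)
  show "P \<oplus>\<^sub>k (- A) @\<^sub>c - (1\<^sub>m N \<otimes>\<^sub>k B) \<in> carrier_mat (N * n) (N * n + N * m)"
    by (intro carrier_append_cols minus_carrier_mat uminus_carrier_mat smult_carrier_mat
        one_carrier_mat zero_carrier_mat A B A' B' k s; simp add: mult.commute)
  show "F \<otimes>\<^sub>k 1\<^sub>m n @\<^sub>c 0\<^sub>m n (m * N) \<in> carrier_mat n (N * n + N * m)"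
    by (intro carrier_append_cols minus_carrier_mat uminus_carrier_mat smult_carrier_mat
        one_carrier_mat zero_carrier_mat A B A' B' k s; simp add: mult.commute)
  show "0\<^sub>m m (n * N) @\<^sub>c F \<otimes>\<^sub>k 1\<^sub>m m \<in> carrier_mat m (N * n + N * m)"
    by (intro carrier_append_cols minus_carrier_mat uminus_carrier_mat smult_carrier_mat
        one_carrier_mat zero_carrier_mat A B A' B' k s; simp add: mult.commute)
qed

lemma lhs_mat_carrier: "lhs_mat \<in> carrier_mat (n + (N * n + (n + m))) (n + (m + m))"
  unfolding lhs_mat_def by (intro carrier_append_rows row_carriers)

lemma rhs_mat_carrier: "rhs_mat \<in> carrier_mat (n + (N * n + (n + m))) (N * n + N * m)"
  unfolding rhs_mat_def by (intro carrier_append_rows row_carriers)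

lemma lhs_mat_mult_append:
  assumes x: "x0 \<in> carrier_vec n" and u: "u0 \<in> carrier_vec m" "u1 \<in> carrier_vec m"
  shows "lhs_mat *\<^sub>v (x0 @\<^sub>v u0 @\<^sub>v u1) =
    (A *\<^sub>v x0 - a \<cdot>\<^sub>v x0 + B *\<^sub>v u0) @\<^sub>v - ((S \<otimes>\<^sub>k 1\<^sub>m n) *\<^sub>v x0) @\<^sub>v
    (A' *\<^sub>v x0 - b \<cdot>\<^sub>v x0 + B' *\<^sub>v u0) @\<^sub>v (u1 - b \<cdot>\<^sub>v u0)"
proof -
  have shift: "(M - c \<cdot>\<^sub>m 1\<^sub>m n) *\<^sub>v x0 = M *\<^sub>v x0 - c \<cdot>\<^sub>v x0" if "M \<in> carrier_mat n n" for M c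
    using that x by (subst minus_mult_distrib_mat_vec[of _ n n])
      (auto simp: smult_mat_mult_vec[OF one_carrier_mat x])
  have zero: "0\<^sub>m r c *\<^sub>v v = 0\<^sub>v r" if "v \<in> carrier_vec c" for r c and v :: "real vec"
    using that by (auto intro!: eq_vecI)
  have 1: "((A - a \<cdot>\<^sub>m 1\<^sub>m n) @\<^sub>c B @\<^sub>c 0\<^sub>m n m) *\<^sub>v (x0 @\<^sub>v u0 @\<^sub>v u1) =
      A *\<^sub>v x0 - a \<cdot>\<^sub>v x0 + B *\<^sub>v u0"
    using A B x u by (subst append_cols3_mult_append[of _ n n _ m _ m])
      (auto simp: shift zero intro!: minus_carrier_mat)
  have 3: "((A' - b \<cdot>\<^sub>m 1\<^sub>m n) @\<^sub>c B' @\<^sub>c 0\<^sub>m n m) *\<^sub>v (x0 @\<^sub>v u0 @\<^sub>v u1) =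
      A' *\<^sub>v x0 - b \<cdot>\<^sub>v x0 + B' *\<^sub>v u0"
    using A' B' x u by (subst append_cols3_mult_append[of _ n n _ m _ m])
      (auto simp: shift zero intro!: minus_carrier_mat)
  have 2: "(- (S \<otimes>\<^sub>k 1\<^sub>m n) @\<^sub>c 0\<^sub>m (n * N) m @\<^sub>c 0\<^sub>m (n * N) m) *\<^sub>v (x0 @\<^sub>v u0 @\<^sub>v u1) =
      - ((S \<otimes>\<^sub>k 1\<^sub>m n) *\<^sub>v x0)"
    using kronecker_carriers(1) x u by (subst append_cols3_mult_append[of _ "N * n" n _ m _ m])
      (auto simp: zero mult.commute)
  have 4: "(0\<^sub>m m n @\<^sub>c - (b \<cdot>\<^sub>m 1\<^sub>m m) @\<^sub>c 1\<^sub>m m) *\<^sub>v (x0 @\<^sub>v u0 @\<^sub>v u1) = u1 - b \<cdot>\<^sub>v u0"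
    using x u by (subst append_cols3_mult_append[of _ m n _ m _ m])
      (auto simp: zero smult_mat_mult_vec[OF one_carrier_mat u(1)] intro!: eq_vecI)
  show ?thesis
    unfolding lhs_mat_def using x u
    by (subst append_rows4_mult[OF row_carriers(1-4)]) (auto simp only: append_carrier_vec 1 2 3 4)
qed

lemma rhs_mat_mult_append:
  assumes X: "X \<in> carrier_vec (N * n)" and U: "U \<in> carrier_vec (N * m)"
  shows "rhs_mat *\<^sub>v (X @\<^sub>v U) =
    (P0 \<otimes>\<^sub>k 1\<^sub>m n) *\<^sub>v X @\<^sub>v
    ((P \<otimes>\<^sub>k 1\<^sub>m n) *\<^sub>v X + (1\<^sub>m N \<otimes>\<^sub>k (- A)) *\<^sub>v X - (1\<^sub>m N \<otimes>\<^sub>k B) *\<^sub>v U) @\<^sub>v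
    (F \<otimes>\<^sub>k 1\<^sub>m n) *\<^sub>v X @\<^sub>v (F \<otimes>\<^sub>k 1\<^sub>m m) *\<^sub>v U"
proof -
  have zero: "0\<^sub>m r c *\<^sub>v v = 0\<^sub>v r" if "v \<in> carrier_vec c" for r c and v :: "real vec"
    using that by (auto intro!: eq_vecI)
  note k = kronecker_carriers
  have 1: "(P0 \<otimes>\<^sub>k 1\<^sub>m n @\<^sub>c 0\<^sub>m n (m * N)) *\<^sub>v (X @\<^sub>v U) = (P0 \<otimes>\<^sub>k 1\<^sub>m n) *\<^sub>v X"
    using k X U by (subst append_cols_mult_append[of _ n "N * n" _ "N * m"])
      (auto simp: zero mult.commute)
  have 3: "(F \<otimes>\<^sub>k 1\<^sub>m n @\<^sub>c 0\<^sub>m n (m * N)) *\<^sub>v (X @\<^sub>v U) = (F \<otimes>\<^sub>k 1\<^sub>m n) *\<^sub>v X"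
    using k X U by (subst append_cols_mult_append[of _ n "N * n" _ "N * m"])
      (auto simp: zero mult.commute)
  have 4: "(0\<^sub>m m (n * N) @\<^sub>c F \<otimes>\<^sub>k 1\<^sub>m m) *\<^sub>v (X @\<^sub>v U) = (F \<otimes>\<^sub>k 1\<^sub>m m) *\<^sub>v U"
    using k X U by (subst append_cols_mult_append[of _ m "N * n" _ "N * m"])
      (auto simp: zero mult.commute)
  have 2: "(P \<oplus>\<^sub>k (- A) @\<^sub>c - (1\<^sub>m N \<otimes>\<^sub>k B)) *\<^sub>v (X @\<^sub>v U) =
      (P \<otimes>\<^sub>k 1\<^sub>m n) *\<^sub>v X + (1\<^sub>m N \<otimes>\<^sub>k (- A)) *\<^sub>v X - (1\<^sub>m N \<otimes>\<^sub>k B) *\<^sub>v U"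
  proof -
    have "(P \<oplus>\<^sub>k (- A) @\<^sub>c - (1\<^sub>m N \<otimes>\<^sub>k B)) *\<^sub>v (X @\<^sub>v U) =
        (P \<oplus>\<^sub>k (- A)) *\<^sub>v X + (- (1\<^sub>m N \<otimes>\<^sub>k B)) *\<^sub>v U"
      using k X U by (intro append_cols_mult_append[of _ "N * n" "N * n" _ "N * m"])
        (auto simp: kronecker_sum_expand)
    also have "(- (1\<^sub>m N \<otimes>\<^sub>k B)) *\<^sub>v U = - ((1\<^sub>m N \<otimes>\<^sub>k B) *\<^sub>v U)"
      using k(6) U by (intro uminus_mult_mat_vec) simp
    also have "(P \<oplus>\<^sub>k (- A)) *\<^sub>v X = (P \<otimes>\<^sub>k 1\<^sub>m n) *\<^sub>v X + (1\<^sub>m N \<otimes>\<^sub>k (- A)) *\<^sub>v X"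
      unfolding kronecker_sum_expand by (rule add_mult_distrib_mat_vec[OF k(5) k(7) X])
    finally show ?thesis using k X U by (subst minus_add_uminus_vec[of _ "N * n"]) auto
  qed
  show ?thesis
    unfolding rhs_mat_def using X U
    by (subst append_rows4_mult[OF row_carriers(5-8)]) (auto simp only: append_carrier_vec 1 2 3 4)
qed

text \<open>The block rows are compared one by one, and the second one block by block as well. In
  the third, \<open>A' *\<^sub>v x0 + B' *\<^sub>v u0\<close> is collected into one vector, to be
  read as the end state.\<close>

lemma block_system_iff:
  assumes x: "x0 \<in> carrier_vec n" and u: "u0 \<in> carrier_vec m" "u1 \<in> carrier_vec m"
    and X: "X \<in> carrier_vec (N * n)" and U: "U \<in> carrier_vec (N * m)"
  shows "lhs_mat *\<^sub>v (x0 @\<^sub>v u0 @\<^sub>v u1) = rhs_mat *\<^sub>v (X @\<^sub>v U) \<longleftrightarrow>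
    (\<forall>k<n. (A *\<^sub>v x0) $ k - a * x0 $ k + (B *\<^sub>v u0) $ k = (\<Sum>i<N. P0 $$ (0, i) * block n X i $ k)) \<and>
    (\<forall>j<N. \<forall>k<n. - S $$ (j, 0) * x0 $ k =
      (\<Sum>i<N. P $$ (j, i) * block n X i $ k) - (A *\<^sub>v block n X j) $ k - (B *\<^sub>v block m U j) $ k) \<and>
    (\<forall>k<n. (A' *\<^sub>v x0 + B' *\<^sub>v u0) $ k - b * x0 $ k = (\<Sum>i<N. F $$ (0, i) * block n X i $ k)) \<and>
    (\<forall>k<m. u1 $ k - b * u0 $ k = (\<Sum>i<N. F $$ (0, i) * block m U i $ k))"
proof -
  note k = kronecker_carriers
  have row0: "((K \<otimes>\<^sub>k 1\<^sub>m d) *\<^sub>v V) $ k = (\<Sum>i<N. K $$ (0, i) * block d V i $ k)"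
    if "K \<in> carrier_mat 1 N" "V \<in> carrier_vec (N * d)" "k < d" for K V d k
    using kronecker_one_mult_nth[of K 1 N V d 0 k] that by simp
  have colS: "((S \<otimes>\<^sub>k 1\<^sub>m n) *\<^sub>v x0) $ (j * n + k) = S $$ (j, 0) * x0 $ k" if "j < N" "k < n" for j k
    using kronecker_one_mult_nth[OF S _ that, of x0] x that by (simp add: block_def)
  have minusA: "((1\<^sub>m N \<otimes>\<^sub>k (- A)) *\<^sub>v X) $ (j * n + k) = - (A *\<^sub>v block n X j) $ k"
    if "j < N" "k < n" for j k
    using one_kronecker_mult_nth[OF uminus_carrier_mat[OF A] X that] that A by (simp add: block_def)
  have e1: "A *\<^sub>v x0 - a \<cdot>\<^sub>v x0 + B *\<^sub>v u0 = (P0 \<otimes>\<^sub>k 1\<^sub>m n) *\<^sub>v X \<longleftrightarrow>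
      (\<forall>k<n. (A *\<^sub>v x0) $ k - a * x0 $ k + (B *\<^sub>v u0) $ k = (\<Sum>i<N. P0 $$ (0, i) * block n X i $ k))"
    using A B x u k(2) mult_mat_vec_carrier[OF k(2) X]
    by (subst eq_vec_iff[of _ n]) (auto simp: row0[OF P0 X] simp del: index_mult_mat_vec)
  have e2: "- ((S \<otimes>\<^sub>k 1\<^sub>m n) *\<^sub>v x0) =
        (P \<otimes>\<^sub>k 1\<^sub>m n) *\<^sub>v X + (1\<^sub>m N \<otimes>\<^sub>k (- A)) *\<^sub>v X - (1\<^sub>m N \<otimes>\<^sub>k B) *\<^sub>v U \<longleftrightarrow>
      (\<forall>j<N. \<forall>k<n. - S $$ (j, 0) * x0 $ k =
        (\<Sum>i<N. P $$ (j, i) * block n X i $ k) - (A *\<^sub>v block n X j) $ k - (B *\<^sub>v block m U j) $ k)"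
    using k x X U mult_add_less[of _ N _ n]
    by (subst eq_vec_blocks_iff[of _ N n])
       (auto simp: colS minusA kronecker_one_mult_nth[OF P X] one_kronecker_mult_nth[OF B U]
         simp del: index_mult_mat_vec)
  have e3: "A' *\<^sub>v x0 - b \<cdot>\<^sub>v x0 + B' *\<^sub>v u0 = (F \<otimes>\<^sub>k 1\<^sub>m n) *\<^sub>v X \<longleftrightarrow>
      (\<forall>k<n. (A' *\<^sub>v x0 + B' *\<^sub>v u0) $ k - b * x0 $ k = (\<Sum>i<N. F $$ (0, i) * block n X i $ k))"
    using A' B' x u k(3) mult_mat_vec_carrier[OF k(3) X] by (subst eq_vec_iff[of _ n])
      (auto simp: row0[OF F X] algebra_simps simp del: index_mult_mat_vec)
  have e4: "u1 - b \<cdot>\<^sub>v u0 = (F \<otimes>\<^sub>k 1\<^sub>m m) *\<^sub>v U \<longleftrightarrow>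
      (\<forall>k<m. u1 $ k - b * u0 $ k = (\<Sum>i<N. F $$ (0, i) * block m U i $ k))"
    using u k(4) mult_mat_vec_carrier[OF k(4) U]
    by (subst eq_vec_iff[of _ m]) (auto simp: row0[OF F U] simp del: index_mult_mat_vec)
  show ?thesis
    unfolding lhs_mat_mult_append[OF x u] rhs_mat_mult_append[OF X U] e1[symmetric] e2[symmetric]
      e3[symmetric] e4[symmetric]
    using A B A' B' x u X U k mult_mat_vec_carrier[OF k(2) X] mult_mat_vec_carrier[OF k(3) X]
      minus_carrier_vec[OF add_carrier_vec[OF mult_mat_vec_carrier[OF k(5) X]
        mult_mat_vec_carrier[OF k(7) X]] mult_mat_vec_carrier[OF k(6) U]]
    by (intro eq_append_vec4_iff[of _ n _ _ "N * n" _ _ n]) auto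
qed

end


text \<open>Inserts the concrete quadrature data. That the first node is 0 identifies psi_0, defined
  by derivatives at that node, with the derivatives at 0 in the nodal equations.\<close>

lemma nodal_equations_iff_block_system:
  assumes A: "A\<^sub>c \<in> carrier_mat n n" and B: "B\<^sub>c \<in> carrier_mat n m"
    and A': "A\<^sub>d \<in> carrier_mat n n" and B': "B\<^sub>d \<in> carrier_mat n m" and "\<tau> > 0"
    and x: "x0 \<in> carrier_vec n" and u: "u0 \<in> carrier_vec m" "u1 \<in> carrier_vec m"
    and X: "X \<in> carrier_vec (N * n)" and U: "U \<in> carrier_vec (N * m)"
  shows "nodal_equations N \<tau> n m A\<^sub>c B\<^sub>c x0 (A\<^sub>d *\<^sub>v x0 + B\<^sub>d *\<^sub>v u0) u0 u1 (block n X) (block m U) \<longleftrightarrow>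
    lhs_mat n m N A\<^sub>c B\<^sub>c A\<^sub>d B\<^sub>d ((sigma_mat N \<tau>)\<^sup>T)
      (poly (pderiv (lagrange N \<tau> 0)) 0) (poly (lagrange N \<tau> 0) \<tau>) *\<^sub>v (x0 @\<^sub>v u0 @\<^sub>v u1) =
    rhs_mat n m N A\<^sub>c B\<^sub>c ((psi_mat N \<tau> 0)\<^sup>T) ((Psi_mat N \<tau>)\<^sup>T) ((Phi_mat N \<tau>)\<^sup>T) *\<^sub>v (X @\<^sub>v U)"
  using node_zero_inj_on(1)[OF \<open>\<tau> > 0\<close>]
  by (subst block_system_iff[OF A B A' B' _ _ _ _ x u X U])
     (simp_all add: nodal_equations_def sigma_mat_def psi_mat_def Psi_mat_def Phi_mat_def
       del: index_mult_mat_vec index_add_vec)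

theorem theorem1:
  fixes n m N :: nat and \<tau> :: real
    and A\<^sub>c B\<^sub>c A\<^sub>d B\<^sub>d :: "real mat"
  assumes "A\<^sub>c \<in> carrier_mat n n" and "B\<^sub>c \<in> carrier_mat n m"
    and "A\<^sub>d \<in> carrier_mat n n" and "B\<^sub>d \<in> carrier_mat n m"
    and "\<tau> > 0" and "N \<ge> 1"
  shows "system_interpolator N \<tau> n m A\<^sub>c B\<^sub>c A\<^sub>d B\<^sub>d \<longleftrightarrow>
    col_space
      (((A\<^sub>c - poly (pderiv (lagrange N \<tau> 0)) 0 \<cdot>\<^sub>m 1\<^sub>m n) @\<^sub>c B\<^sub>c @\<^sub>c 0\<^sub>m n m) @\<^sub>r
       (- ((sigma_mat N \<tau>)\<^sup>T \<otimes>\<^sub>k 1\<^sub>m n) @\<^sub>c 0\<^sub>m (n * N) m @\<^sub>c 0\<^sub>m (n * N) m) @\<^sub>r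
       ((A\<^sub>d - poly (lagrange N \<tau> 0) \<tau> \<cdot>\<^sub>m 1\<^sub>m n) @\<^sub>c B\<^sub>d @\<^sub>c 0\<^sub>m n m) @\<^sub>r
       (0\<^sub>m m n @\<^sub>c - (poly (lagrange N \<tau> 0) \<tau> \<cdot>\<^sub>m 1\<^sub>m m) @\<^sub>c 1\<^sub>m m))
    \<subseteq> col_space
      (((psi_mat N \<tau> 0)\<^sup>T \<otimes>\<^sub>k 1\<^sub>m n @\<^sub>c 0\<^sub>m n (m * N)) @\<^sub>r
       ((Psi_mat N \<tau>)\<^sup>T \<oplus>\<^sub>k (- A\<^sub>c) @\<^sub>c - (1\<^sub>m N \<otimes>\<^sub>k B\<^sub>c)) @\<^sub>r
       ((Phi_mat N \<tau>)\<^sup>T \<otimes>\<^sub>k 1\<^sub>m n @\<^sub>c 0\<^sub>m n (m * N)) @\<^sub>r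
       (0\<^sub>m m (n * N) @\<^sub>c (Phi_mat N \<tau>)\<^sup>T \<otimes>\<^sub>k 1\<^sub>m m))"
proof -
  note A = assms(1) and B = assms(2) and A' = assms(3) and B' = assms(4)
  let ?L = "lhs_mat n m N A\<^sub>c B\<^sub>c A\<^sub>d B\<^sub>d ((sigma_mat N \<tau>)\<^sup>T)
      (poly (pderiv (lagrange N \<tau> 0)) 0) (poly (lagrange N \<tau> 0) \<tau>)"
  let ?R = "rhs_mat n m N A\<^sub>c B\<^sub>c ((psi_mat N \<tau> 0)\<^sup>T) ((Psi_mat N \<tau>)\<^sup>T) ((Phi_mat N \<tau>)\<^sup>T)"
  have c: "(psi_mat N \<tau> 0)\<^sup>T \<in> carrier_mat 1 N" "(Psi_mat N \<tau>)\<^sup>T \<in> carrier_mat N N"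
    "(sigma_mat N \<tau>)\<^sup>T \<in> carrier_mat N 1" "(Phi_mat N \<tau>)\<^sup>T \<in> carrier_mat 1 N"
    by (simp_all add: psi_mat_def Psi_mat_def sigma_mat_def Phi_mat_def)
  have solvable: "one_step_interpolable N \<tau> n m A\<^sub>c B\<^sub>c x0 (A\<^sub>d *\<^sub>v x0 + B\<^sub>d *\<^sub>v u0) u0 u1 \<longleftrightarrow>
      (\<exists>w\<in>carrier_vec (N * n + N * m). ?L *\<^sub>v (x0 @\<^sub>v u0 @\<^sub>v u1) = ?R *\<^sub>v w)"
    if x: "x0 \<in> carrier_vec n" and u: "u0 \<in> carrier_vec m" "u1 \<in> carrier_vec m" for x0 u0 u1
  proof -
    have "one_step_interpolable N \<tau> n m A\<^sub>c B\<^sub>c x0 (A\<^sub>d *\<^sub>v x0 + B\<^sub>d *\<^sub>v u0) u0 u1 \<longleftrightarrow>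
        (\<exists>X\<in>carrier_vec (N * n). \<exists>U\<in>carrier_vec (N * m). ?L *\<^sub>v (x0 @\<^sub>v u0 @\<^sub>v u1) = ?R *\<^sub>v (X @\<^sub>v U))"
      unfolding one_step_iff_nodal_equations[OF A B \<open>\<tau> > 0\<close> x u(1)]
      by (intro bex_cong refl nodal_equations_iff_block_system A B A' B' \<open>\<tau> > 0\<close> x u)
    also have "\<dots> \<longleftrightarrow> (\<exists>w\<in>carrier_vec (N * n + N * m). ?L *\<^sub>v (x0 @\<^sub>v u0 @\<^sub>v u1) = ?R *\<^sub>v w)"
      by (rule bex_carrier_append[symmetric])
    finally show ?thesis .
  qed
  have "system_interpolator N \<tau> n m A\<^sub>c B\<^sub>c A\<^sub>d B\<^sub>d \<longleftrightarrow>
    (\<forall>x0\<in>carrier_vec n. \<forall>u0\<in>carrier_vec m. \<forall>u1\<in>carrier_vec m.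
      one_step_interpolable N \<tau> n m A\<^sub>c B\<^sub>c x0 (A\<^sub>d *\<^sub>v x0 + B\<^sub>d *\<^sub>v u0) u0 u1)"
    using interpolator_imp_one_step[OF A B \<open>\<tau> > 0\<close> A' B'] one_step_imp_interpolator[OF A B \<open>\<tau> > 0\<close> A' B']
    by blast
  also have "\<dots> \<longleftrightarrow> (\<forall>x0\<in>carrier_vec n. \<forall>u0\<in>carrier_vec m. \<forall>u1\<in>carrier_vec m.
      \<exists>w\<in>carrier_vec (N * n + N * m). ?L *\<^sub>v (x0 @\<^sub>v u0 @\<^sub>v u1) = ?R *\<^sub>v w)"
    by (intro ball_cong refl solvable)
  \<comment> \<open>The data \<open>x0\<close>, \<open>u0\<close>, \<open>u1\<close> range
    independently over their spaces, so stacked they form an arbitrary argument of the left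
    matrix.\<close>
  also have "\<dots> \<longleftrightarrow> (\<forall>v\<in>carrier_vec (n + (m + m)). \<exists>w\<in>carrier_vec (N * n + N * m). ?L *\<^sub>v v = ?R *\<^sub>v w)"
    by (simp only: ball_carrier_append)
  also have "\<dots> \<longleftrightarrow> col_space ?L \<subseteq> col_space ?R"
    by (rule col_space_subset_iff[symmetric, OF lhs_mat_carrier[OF A B A' B' c] rhs_mat_carrier[OF A B A' B' c]])
  finally show ?thesis
    by (simp only: lhs_mat_def[OF A B A' B' c] rhs_mat_def[OF A B A' B' c])
qed

end
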